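(* Let $r,m\geqslant 1$ be integers. Define the formal power series $$\ell_{m}(x) = \sum_{d \geqslant 0} W_m(dm)\,\lambda(m,dm)\,x^d,\qquad h_m(x) = \sum_{d \geqslant 0} W_m(dm)\,x^d .$$ Let $f_{r,m}(x)\in\mathbb{Z}[[x]]$ satisfy the functional equation $$f_{r,m}(x) = x\,\bigl(\ell_m(f_{r,m}(x))\bigr)^r .$$ Then the generating function $$F_{(r,m)}(x) = \sum_{n \geqslant 0} FC_{n}^{(r,m)}\,x^{n+1}$$ of the Hypergraph Fuss-Catalan numbers satisfies $$F_{(r,m)}(x) = x\, h_{m}\bigl(f_{r,m}(FC_{1}^{(r,m)}\,x)\bigr).$$
   Context: **Coefficients.** For $m\mid k$, $W_m(k)=\dfrac{k!}{(m!)^{k/m}(k/m)!}$ is the number of ways to partition a set of cardinality $k$ into subsets of cardinality $m$. Also $\lambda(r,g)=\binom{r-1+g}{r-1}$ is the dimension of the space of homogeneous polynomials of degree $g$ in $r$ variables. **Hypertrees.** An $(r+1)$-uniform hypertree with $n$ hyperedges is a connected hypergraph with $rn+1$ vertices and $n$ hyperedges, each hyperedge being a set of exactly $r+1$ vertices (for $n=0$: a single vertex and no hyperedges). Let $\mathcal{H}_n^{(r+1)}$ be the set of isomorphism classes (unlabeled, unrooted) of $(r+1)$-uniform hypertrees with $n$ hyperedges. For $T\in\mathcal{H}_n^{(r+1)}$, $\Gamma(T)$ is the automorphism group of $T$ (permutations of the vertices that map hyperedges to hyperedges). The associated bipartite graph $\tilde T$ has one black vertex for each vertex of $T$ and one white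 vertex for each hyperedge of $T$, a black vertex being adjacent to a white vertex exactly when the corresponding vertex belongs to the corresponding hyperedge; $\tilde T$ is a tree. **Walks.** For a black vertex $v$ of $\tilde T$, let $a_T^{(r,m)}(v)$ be the number of walks on $\tilde T$ that (1) begin and end at $v$; (2) use every edge of $\tilde T$ exactly $2m$ times, $m$ times going away from $v$ and $m$ times coming back towards $v$ (with $\tilde T$ regarded as rooted at $v$); (3) contain no consecutive subsequence of the form $v_1v_2v_1$ with $v_1$ black and $v_2$ white. **Hypergraph Fuss-Catalan numbers.** $$FC_n^{(r,m)} = \sum_{T\in\mathcal{H}_n^{(r+1)}}\ \sum_{v} \frac{a_T^{(r,m)}(v)}{|\Gamma(T)|},$$ the inner sum being over the black vertices $v$ of $\tilde T$. *)

theory Defs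
  imports
    "HOL-Computational_Algebra.Formal_Power_Series"
    "HOL-Combinatorics.Permutations"
    "HOL-Library.Sublist"
begin

section \<open>Coefficients\<close>

text \<open>Only used for \<open>m dvd k\<close>, when the division is exact (\<open>W_times\<close> below).\<close>

definition W :: "nat \<Rightarrow> nat \<Rightarrow> nat" where
  "W m k = fact k div (fact m ^ (k div m) * fact (k div m))"

lemma W_dvd:
  assumes "m \<ge> 1"
  shows "(fact m ^ d * fact d :: nat) dvd fact (d * m)"
proof (induction d)
  case 0
  then show ?case by simp
next
  case (Suc d)
  obtain q where m: "m = Suc q" using assms by (cases m) auto
  let ?N = "d * m + q"
  have N: "Suc d * m = Suc ?N" by (simp add: m)
  have "Suc q * (Suc ?N choose Suc q) = Suc ?N * (?N choose q)"
    by (rule Suc_times_binomial)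
  also have "\<dots> = Suc q * (Suc d * (?N choose q))"
    by (simp add: m algebra_simps)
  finally have "(Suc ?N choose Suc q) = Suc d * (?N choose q)"
    by (metis mult_left_cancel nat.distinct(1))
  moreover have "fact (Suc q) * fact (Suc ?N - Suc q) * (Suc ?N choose Suc q) = (fact (Suc ?N) :: nat)"
    by (rule binomial_fact_lemma) simp
  moreover have "Suc ?N - Suc q = d * m" by simp
  ultimately have "fact (Suc d * m) = fact m * fact (d * m) * (Suc d * (?N choose q))"
    unfolding N unfolding m by metis
  then have eq: "fact (Suc d * m) = (fact m * Suc d * fact (d * m)) * (?N choose q)"
    by (simp only: ac_simps)
  have "(fact m * Suc d) * (fact m ^ d * fact d :: nat) dvd (fact m * Suc d) * fact (d * m)"
    using Suc.IH by (rule mult_dvd_mono[OF dvd_refl])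
  also have "(fact m * Suc d) * (fact m ^ d * fact d :: nat) = fact m ^ Suc d * fact (Suc d)"
    by (simp only: power_Suc fact_Suc of_nat_id ac_simps)
  finally have "fact m ^ Suc d * fact (Suc d) dvd fact m * Suc d * fact (d * m)" .
  then show ?case unfolding eq by (rule dvd_mult2)
qed

lemma W_times:
  assumes "m \<ge> 1"
  shows "W m (d * m) * (fact m ^ d * fact d) = fact (d * m)"
  using W_dvd[OF assms, of d] assms by (simp add: W_def)

definition lam :: "nat \<Rightarrow> nat \<Rightarrow> nat" where
  "lam r g = (r - 1 + g) choose (r - 1)"

definition ell :: "nat \<Rightarrow> 'a::semiring_1 fps" where
  "ell m = Abs_fps (\<lambda>d. of_nat (W m (d * m) * lam m (d * m)))"

definition h :: "nat \<Rightarrow> 'a::semiring_1 fps" where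
  "h m = Abs_fps (\<lambda>d. of_nat (W m (d * m)))"

text \<open>The coefficientwise inclusion of \<open>int\<close> power series into \<open>rat\<close> power series.\<close>

definition rat_fps :: "int fps \<Rightarrow> rat fps" where
  "rat_fps f = Abs_fps (\<lambda>n. of_int (fps_nth f n))"

section \<open>Hypertrees\<close>

type_synonym 'a hypergraph = "'a set \<times> 'a set set"

abbreviation verts :: "'a hypergraph \<Rightarrow> 'a set" where "verts \<equiv> fst"
abbreviation hedges :: "'a hypergraph \<Rightarrow> 'a set set" where "hedges \<equiv> snd"

definition hconnected :: "'a hypergraph \<Rightarrow> bool" where
  "hconnected T \<longleftrightarrow>
     (\<forall>u\<in>verts T. \<forall>v\<in>verts T. (u, v) \<in> {(x, y). \<exists>e\<in>hedges T. x \<in> e \<and> y \<in> e}\<^sup>*)"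

text \<open>\<open>hypertree r n T\<close>: \<open>T\<close> is an \<open>(r+1)\<close>-uniform hypertree with \<open>n\<close> hyperedges.\<close>

definition hypertree :: "nat \<Rightarrow> nat \<Rightarrow> 'a hypergraph \<Rightarrow> bool" where
  "hypertree r n T \<longleftrightarrow>
     finite (verts T) \<and> card (verts T) = r * n + 1 \<and>
     finite (hedges T) \<and> card (hedges T) = n \<and>
     (\<forall>e\<in>hedges T. e \<subseteq> verts T \<and> card e = r + 1) \<and>
     hconnected T"

definition hiso :: "'a hypergraph \<Rightarrow> 'b hypergraph \<Rightarrow> bool" where
  "hiso S T \<longleftrightarrow> (\<exists>p. bij_betw p (verts S) (verts T) \<and> (`) p ` hedges S = hedges T)"

definition hypertrees :: "nat \<Rightarrow> nat \<Rightarrow> nat hypergraph set" where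
  "hypertrees r n = {T. hypertree r n T \<and> verts T = {..<r * n + 1}}"

text \<open>Isomorphism classes, formed on a standard vertex set; \<open>hypertree_relabel\<close> shows that
  no class is lost.\<close>

definition hypertree_classes :: "nat \<Rightarrow> nat \<Rightarrow> nat hypergraph set set" where
  "hypertree_classes r n =
     hypertrees r n // {(S, T). S \<in> hypertrees r n \<and> T \<in> hypertrees r n \<and> hiso S T}"

lemma hypertree_relabel:
  fixes T :: "'a hypergraph"
  assumes T: "hypertree r n T"
  shows "\<exists>S\<in>hypertrees r n. hiso T S"
proof -
  obtain p where p: "bij_betw p (verts T) {..<r * n + 1}"
    using T finite_same_card_bij[of "verts T" "{..<r * n + 1}"] by (auto simp: hypertree_def)
  then have inj: "inj_on p (verts T)" and im: "p ` verts T = {..<r * n + 1}"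
    by (auto simp: bij_betw_def)
  have sub: "e \<subseteq> verts T" "card e = r + 1" if "e \<in> hedges T" for e
    using T that by (auto simp: hypertree_def)
  let ?S = "({..<r * n + 1}, (`) p ` hedges T)"
  have "inj_on ((`) p) (hedges T)"
    by (rule inj_on_subset[OF inj_on_image_Pow[OF inj]]) (use sub in auto)
  then have 1: "card (hedges ?S) = n"
    using T by (simp add: card_image hypertree_def)
  have 2: "e \<subseteq> verts ?S \<and> card e = r + 1" if "e \<in> hedges ?S" for e
  proof -
    obtain e' where e': "e' \<in> hedges T" "e = p ` e'" using \<open>e \<in> hedges ?S\<close> by auto
    show ?thesis
      using sub[OF e'(1)] im card_image[OF inj_on_subset[OF inj sub(1)[OF e'(1)]]] e'(2) by auto
  qed
  let ?R = "{(x, y). \<exists>e\<in>hedges T. x \<in> e \<and> y \<in> e}"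
  let ?Q = "{(x, y). \<exists>e\<in>hedges ?S. x \<in> e \<and> y \<in> e}"
  have step: "(p u, p v) \<in> ?Q\<^sup>*" if "(u, v) \<in> ?R\<^sup>*" for u v
    using that
  proof induction
    case (step y z)
    then have "(p y, p z) \<in> ?Q" by auto
    then show ?case using step.IH by (rule rtrancl_into_rtrancl[rotated])
  qed simp
  have 3: "hconnected ?S"
    unfolding hconnected_def
  proof (intro ballI)
    fix x y assume "x \<in> verts ?S" "y \<in> verts ?S"
    then obtain u v where "u \<in> verts T" "v \<in> verts T" "x = p u" "y = p v"
      using im by (metis fst_conv imageE)
    then show "(x, y) \<in> ?Q\<^sup>*"
      using step T by (auto simp: hypertree_def hconnected_def)
  qed
  have "hypertree r n ?S"
    using T 1 2 3 by (auto simp: hypertree_def)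
  then have "?S \<in> hypertrees r n" by (simp add: hypertrees_def)
  moreover have "hiso T ?S" using p by (auto simp: hiso_def)
  ultimately show ?thesis by blast
qed

definition Aut :: "'a hypergraph \<Rightarrow> ('a \<Rightarrow> 'a) set" where
  "Aut T = {p. p permutes verts T \<and> (\<forall>e\<in>hedges T. p ` e \<in> hedges T)}"

section \<open>Walks on the associated bipartite graph\<close>

text \<open>Black vertices are \<open>Inl v\<close>, white vertices are \<open>Inr e\<close>.\<close>

definition bip_verts :: "'a hypergraph \<Rightarrow> ('a + 'a set) set" where
  "bip_verts T = Inl ` verts T \<union> Inr ` hedges T"

definition bip_adj :: "'a hypergraph \<Rightarrow> 'a + 'a set \<Rightarrow> 'a + 'a set \<Rightarrow> bool" where
  "bip_adj T x y \<longleftrightarrow>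
     (\<exists>v\<in>verts T. \<exists>e\<in>hedges T. v \<in> e \<and> (x = Inl v \<and> y = Inr e \<or> x = Inr e \<and> y = Inl v))"

definition walk :: "'a hypergraph \<Rightarrow> ('a + 'a set) list \<Rightarrow> bool" where
  "walk T p \<longleftrightarrow> p \<noteq> [] \<and> set p \<subseteq> bip_verts T \<and> successively (bip_adj T) p"

definition walk_between ::
  "'a hypergraph \<Rightarrow> 'a + 'a set \<Rightarrow> ('a + 'a set) list \<Rightarrow> 'a + 'a set \<Rightarrow> bool" where
  "walk_between T x p y \<longleftrightarrow> walk T p \<and> hd p = x \<and> last p = y"

text \<open>The depth of \<open>x\<close> in the bipartite tree rooted at \<open>u\<close>. A step from \<open>x\<close> to \<open>y\<close> goes away from
  the root if it increases the depth, and back towards the root if it decreases it.\<close>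

definition depth :: "'a hypergraph \<Rightarrow> 'a + 'a set \<Rightarrow> 'a + 'a set \<Rightarrow> nat" where
  "depth T u x = (LEAST k. \<exists>p. walk_between T u p x \<and> length p = Suc k)"

definition away :: "'a hypergraph \<Rightarrow> 'a + 'a set \<Rightarrow> 'a + 'a set \<Rightarrow> 'a + 'a set \<Rightarrow> bool" where
  "away T u x y \<longleftrightarrow> bip_adj T x y \<and> depth T u y = Suc (depth T u x)"

text \<open>The number of steps of \<open>p\<close> that go from \<open>x\<close> to \<open>y\<close>.\<close>

definition steps :: "'b list \<Rightarrow> 'b \<Rightarrow> 'b \<Rightarrow> nat" where
  "steps p x y = count_list (zip p (tl p)) (x, y)"

definition fc_walks :: "nat \<Rightarrow> 'a hypergraph \<Rightarrow> 'a \<Rightarrow> ('a + 'a set) list set" where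
  "fc_walks m T v = {p.
     walk_between T (Inl v) p (Inl v) \<and>
     (\<forall>x y. bip_adj T x y \<longrightarrow> steps p x y + steps p y x = 2 * m) \<and>
     (\<forall>x y. away T (Inl v) x y \<longrightarrow> steps p x y = m \<and> steps p y x = m) \<and>
     (\<forall>u e. \<not> sublist [Inl u, Inr e, Inl u] p)}"

section \<open>Hypergraph Fuss-Catalan numbers\<close>

text \<open>The summand only depends on the isomorphism class of the chosen representative.\<close>

definition FC :: "nat \<Rightarrow> nat \<Rightarrow> nat \<Rightarrow> rat" where
  "FC r m n = (\<Sum>C\<in>hypertree_classes r n.
     let T = (SOME T. T \<in> C) in
       \<Sum>v\<in>verts T. of_nat (card (fc_walks m T v)) / of_nat (card (Aut T)))"

definition FC_series :: "nat \<Rightarrow> nat \<Rightarrow> rat fps" where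
  "FC_series r m = Abs_fps (\<lambda>k. case k of 0 \<Rightarrow> 0 | Suc n \<Rightarrow> FC r m n)"

end

theory Submission
  imports Defs "HOL-Library.Disjoint_Sets"
begin

text \<open>Adding a hyperedge \<open>e\<close> that meets the rest only in \<open>u\<close> multiplies the number of walks by a local
  factor: the \<open>m\<close> excursions from \<open>u\<close> into \<open>e\<close> are distributed over the visits to \<open>u\<close>, and the number
  of ways to run through the excursions themselves is the constant \<open>c = r! FC\<^sub>1\<close>. For the hyperedges
  attached to one vertex these factors multiply to the coefficients of \<open>h\<^sub>m\<close> at the root and of \<open>\<ell>\<^sub>m\<close>
  elsewhere. Peeling off one root after another in a forest of labelled rooted hypertrees yields a
  recursion that is also satisfied by the coefficients of the powers of \<open>\<ell>\<^sub>m(f)\<close>. Orbit counting turns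
  the sum over isomorphism classes into a sum over labelled hypertrees.\<close>

text \<open>Every bipartite edge leads away from the start in one of its two directions, so
  condition (2) says that each incidence is crossed \<open>m\<close> times each way. This no longer
  mentions the root, and gluing on a hyperedge at one vertex \<open>u\<close> changes the count only
  through the visits to \<open>u\<close>: \<open>m\<close> for each hyperedge already there, and one
  more if the walk starts at \<open>u\<close>. Distributing \<open>m\<close> ordered excursions over
  \<open>N\<close> visits gives \<open>(N + m - 1) choose m\<close>. Over \<open>d\<close>
  hyperedges the product telescopes to \<open>d!\<close> times a coefficient of \<open>h\<close> (no
  visits but the start) or of \<open>ell\<close> (one hyperedge already present); the
  \<open>d!\<close> cancels because the hyperedges at a vertex form an unordered family.

  Peeling a root with \<open>d\<close> hyperedges makes its \<open>r * d\<close> neighbours roots,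
  so the induction has to carry an arbitrary set \<open>R\<close> of pending roots and the part
  \<open>P\<close> built so far. The answer is a coefficient of \<open>L ^ card R\<close>: the step
  from \<open>card R\<close> to \<open>card R - 1 + r * d\<close> roots with \<open>n - d\<close>
  hyperedges left is the expansion of one factor \<open>L = ell m oo f\<close> by means of
  \<open>f = fps_X * L ^ r\<close>.\<close>

unbundle fps_syntax

section \<open>Circuits\<close>

type_synonym 'a arc = "'a \<times> 'a set \<times> 'a"

text \<open>A walk \<open>v\<^sub>0 e\<^sub>1 v\<^sub>1 e\<^sub>2 \<dots>\<close> on the bipartite graph is encoded as the list of its arcs
  \<open>(v\<^sub>i, e\<^sub>i\<^sub>+\<^sub>1, v\<^sub>i\<^sub>+\<^sub>1)\<close> through white vertices; condition (3) becomes \<open>v\<^sub>i \<noteq> v\<^sub>i\<^sub>+\<^sub>1\<close>.\<close>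

fun arcs_from :: "'a \<Rightarrow> 'a arc list \<Rightarrow> bool" where
  "arcs_from v [] \<longleftrightarrow> True"
| "arcs_from v ((x, e, y) # q) \<longleftrightarrow> x = v \<and> x \<in> e \<and> y \<in> e \<and> x \<noteq> y \<and> arcs_from y q"

fun arcs_end :: "'a \<Rightarrow> 'a arc list \<Rightarrow> 'a" where
  "arcs_end v [] = v"
| "arcs_end v ((x, e, y) # q) = arcs_end y q"

abbreviation arc_edge :: "'a arc \<Rightarrow> 'a set" where "arc_edge a \<equiv> fst (snd a)"
abbreviation arc_target :: "'a arc \<Rightarrow> 'a" where "arc_target a \<equiv> snd (snd a)"

definition n_dep :: "'a arc list \<Rightarrow> 'a \<Rightarrow> 'a set \<Rightarrow> nat" where
  "n_dep q u e = length (filter (\<lambda>a. fst a = u \<and> arc_edge a = e) q)"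

definition n_arr :: "'a arc list \<Rightarrow> 'a \<Rightarrow> 'a set \<Rightarrow> nat" where
  "n_arr q u e = length (filter (\<lambda>a. arc_target a = u \<and> arc_edge a = e) q)"

text \<open>\<open>n_dep q u e\<close> and \<open>n_arr q u e\<close> count the crossings of the
  bipartite edge between \<open>u\<close> and \<open>e\<close> in its two directions. Asking for
  \<open>m\<close> in each expresses condition (2) without naming the direction away from the
  start.\<close>

definition circuits :: "nat \<Rightarrow> 'a set set \<Rightarrow> 'a \<Rightarrow> 'a arc list set" where
  "circuits m E v = {q. arcs_from v q \<and> arcs_end v q = v \<and> arc_edge ` set q \<subseteq> E \<and>
     (\<forall>e\<in>E. \<forall>u\<in>e. n_dep q u e = m \<and> n_arr q u e = m)}"

lemma arcs_fromD: "arcs_from v q \<Longrightarrow> a \<in> set q \<Longrightarrow> fst a \<in> arc_edge a \<and> arc_target a \<in> arc_edge a"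
  by (induction v q rule: arcs_from.induct) auto

text \<open>An arc from \<open>u\<close> through \<open>e\<close> is one of the \<open>m\<close>
  departures from \<open>u\<close> into \<open>e\<close>, so no arc occurs more than
  \<open>m\<close> times. This bounds the length by \<open>m\<close> times the number of possible
  arcs.\<close>

lemma finite_circuits:
  assumes "finite E" and "\<And>e. e \<in> E \<Longrightarrow> finite e"
  shows "finite (circuits m E v)"
proof -
  let ?A = "\<Union>E \<times> E \<times> \<Union>E"
  have fin: "finite ?A" using assms by auto
  have "set q \<subseteq> ?A \<and> length q \<le> m * card ?A" if q: "q \<in> circuits m E v" for q
  proof -
    have mem: "arc_edge a \<in> E \<and> fst a \<in> arc_edge a \<and> arc_target a \<in> arc_edge a" if "a \<in> set q" for a
      using q that arcs_fromD[of v q a] by (auto simp: circuits_def)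
    then have sub: "set q \<subseteq> ?A" by (fastforce simp: mem_Times_iff)
    have "count_list q a \<le> m" if "a \<in> set q" for a
    proof -
      have "count_list q a = length (filter ((=) a) q)" by (simp add: count_list_eq_length_filter)
      also have "filter ((=) a) q = filter ((=) a) (filter (\<lambda>b. fst b = fst a \<and> arc_edge b = arc_edge a) q)"
        by (simp) (rule filter_cong, auto)
      also have "length \<dots> \<le> n_dep q (fst a) (arc_edge a)"
        unfolding n_dep_def by (rule length_filter_le)
      also have "\<dots> = m" using q mem[OF that] by (auto simp: circuits_def)
      finally show ?thesis .
    qed
    then have "(\<Sum>a\<in>set q. count_list q a) \<le> m * card (set q)"
      using sum_bounded_above[of "set q" "count_list q" m] by (simp add: mult.commute)
    then have "length q \<le> m * card (set q)" by (simp add: sum_count_set)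
    also have "\<dots> \<le> m * card ?A" using card_mono[OF fin sub] by simp
    finally show ?thesis using sub by blast
  qed
  then have "circuits m E v \<subseteq> {q. set q \<subseteq> ?A \<and> length q \<le> m * card ?A}" by blast
  then show ?thesis using finite_lists_length_le[OF fin] by (rule finite_subset)
qed

text \<open>At any time the walk is either at the current vertex \<open>x\<close> of its part outside \<open>e\<close> (with the part in
  \<open>e\<close> resting at \<open>u\<close>), or inside an excursion into \<open>e\<close> at \<open>y \<noteq> u\<close> (with the outer part resting at \<open>u\<close>).\<close>

lemma arcs_split:
  assumes eP: "e \<notin> P" "\<And>d. d \<in> P \<Longrightarrow> d \<inter> e \<subseteq> {u}" and u: "u \<in> e"
  shows "arcs_from z q \<Longrightarrow> arc_edge ` set q \<subseteq> insert e P \<Longrightarrow> y \<in> e \<Longrightarrow> x \<notin> e - {u} \<Longrightarrow>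
    z = (if y = u then x else y) \<Longrightarrow> y = u \<or> x = u \<Longrightarrow>
    arcs_from x (filter (\<lambda>a. arc_edge a \<noteq> e) q) \<and> arcs_from y (filter (\<lambda>a. arc_edge a = e) q) \<and>
    arcs_end y (filter (\<lambda>a. arc_edge a = e) q) \<in> e \<and>
    arcs_end z q = (if arcs_end y (filter (\<lambda>a. arc_edge a = e) q) = u
      then arcs_end x (filter (\<lambda>a. arc_edge a \<noteq> e) q) else arcs_end y (filter (\<lambda>a. arc_edge a = e) q))"
proof (induction q arbitrary: x y z)
  case Nil
  then show ?case by simp
next
  case (Cons a q)
  obtain b d w where a: "a = (b, d, w)" by (cases a) auto
  have b: "b = z" "z \<in> d" "w \<in> d" "z \<noteq> w" "arcs_from w q" using Cons.prems(1) a by auto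
  have sub: "arc_edge ` set q \<subseteq> insert e P" using Cons.prems(2) by simp
  show ?case
  proof (cases "d = e")
    case True
    have zy: "z = y" using Cons.prems(4,5) b(2) True by (cases "y = u") auto
    have x: "x = u" using Cons.prems(4-6) b(2) True zy by (cases "y = u") auto
    show ?thesis
      using Cons.IH[OF b(5) sub, of w u] True b zy x a by simp
  next
    case False
    then have dP: "d \<in> P" using Cons.prems(2) a by simp
    have y: "y = u" using eP(2)[OF dP] b(2) Cons.prems(3,5) by (cases "y = u") auto
    then have zx: "z = x" using Cons.prems(5) by simp
    have we: "w \<notin> e - {u}" using eP(2)[OF dP] b(3) by auto
    show ?thesis
      using Cons.IH[OF b(5) sub u we] False b zx y a by simp
  qed
qed

section \<open>Interleaving an outer walk with excursions into one hyperedge\<close>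

text \<open>Nothing is required of the end point: in the situation of \<open>arcs_split\<close> it
  is determined by the ends of the two parts.\<close>

definition merges :: "'a set \<Rightarrow> 'a \<Rightarrow> 'a arc list \<Rightarrow> 'a arc list \<Rightarrow> 'a arc list set" where
  "merges e z q' s =
    {q. arcs_from z q \<and> filter (\<lambda>a. arc_edge a \<noteq> e) q = q' \<and> filter (\<lambda>a. arc_edge a = e) q = s}"

lemma finite_merges: "finite (merges e z q' s)"
proof -
  have "merges e z q' s \<subseteq> shuffles q' s"
    using partition_in_shuffles[of _ "\<lambda>a. arc_edge a \<noteq> e"] by (auto simp: merges_def)
  then show ?thesis by (rule finite_subset) simp
qed

lemma merges_unfold:
  assumes q': "\<forall>a\<in>set q'. arc_edge a \<noteq> e" and s: "\<forall>a\<in>set s. arc_edge a = e"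
  shows "merges e z q' s =
    (if q' = [] \<and> s = [] then {[]} else {}) \<union>
    (if q' \<noteq> [] \<and> arcs_from z [hd q'] then Cons (hd q') ` merges e (arc_target (hd q')) (tl q') s else {}) \<union>
    (if s \<noteq> [] \<and> arcs_from z [hd s] then Cons (hd s) ` merges e (arc_target (hd s)) q' (tl s) else {})"
    (is "?L = ?R")
proof (intro set_eqI)
  fix q
  show "q \<in> ?L \<longleftrightarrow> q \<in> ?R"
  proof (cases q)
    case Nil
    then show ?thesis by (simp add: merges_def) auto
  next
    case (Cons a p)
    have *: "arcs_from z (a # p) \<longleftrightarrow> arcs_from z [a] \<and> arcs_from (arc_target a) p"
      by (cases a) auto
    have img: "a # p \<in> Cons b ` A \<longleftrightarrow> a = b \<and> p \<in> A" for b and A :: "'a arc list set" by auto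
    have cons: "(b # xs = ys) \<longleftrightarrow> ys \<noteq> [] \<and> b = hd ys \<and> xs = tl ys" for b :: "'a arc" and xs ys
      by (cases ys) auto
    have ite: "x \<in> (if Q then A else {}) \<longleftrightarrow> Q \<and> x \<in> A" for x :: "'a arc list" and Q A by simp
    have R: "a # p \<in> ?R \<longleftrightarrow>
      (q' \<noteq> [] \<and> arcs_from z [hd q'] \<and> a = hd q' \<and> p \<in> merges e (arc_target (hd q')) (tl q') s) \<or>
      (s \<noteq> [] \<and> arcs_from z [hd s] \<and> a = hd s \<and> p \<in> merges e (arc_target (hd s)) q' (tl s))"
      unfolding Un_iff ite img by auto
    have q'a: "arc_edge a = e \<Longrightarrow> q' \<noteq> [] \<Longrightarrow> a \<noteq> hd q'" using q' by (metis hd_in_set)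
    have sa: "arc_edge a \<noteq> e \<Longrightarrow> s \<noteq> [] \<Longrightarrow> a \<noteq> hd s" using s by (metis hd_in_set)
    show ?thesis
      unfolding Cons R unfolding merges_def mem_Collect_eq * filter.simps
      using q'a sa by (cases "arc_edge a = e") (auto simp: cons)
  qed
qed

definition n_visits :: "'a \<Rightarrow> 'a arc list \<Rightarrow> nat" where
  "n_visits u q = length (filter (\<lambda>a. arc_target a = u) q)"

lemma n_visits_simps [simp]:
  "n_visits u [] = 0"
  "n_visits u (a # q) = of_bool (arc_target a = u) + n_visits u q"
  by (auto simp: n_visits_def)

lemma n_visits_pos: "arcs_end w q = u \<Longrightarrow> w \<noteq> u \<Longrightarrow> n_visits u q > 0"
proof (induction w q rule: arcs_end.induct)
  case (2 v x e y q)
  then show ?case by (cases "y = u") auto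
qed simp

text \<open>Stars and bars. The outer part stands at \<open>x\<close>, the part in \<open>e\<close>
  at \<open>y\<close>. Each excursion still to be started ends with one arrival of \<open>s\<close>
  at \<open>u\<close>; if \<open>y\<close> differs from \<open>u\<close>, one of these arrivals
  belongs to the excursion under way, hence the \<open>- 1\<close> in \<open>M\<close>. The slots
  are the visits of the outer part to \<open>u\<close>, the present one included. With no slot the
  formula gives 1 for \<open>M = 0\<close> and 0 otherwise, as it should.\<close>

lemma card_merges:
  assumes "e \<notin> P" "\<And>d. d \<in> P \<Longrightarrow> d \<inter> e \<subseteq> {u}" "u \<in> e"
    and "arc_edge ` set q' \<subseteq> P" "arc_edge ` set s \<subseteq> {e}" "arcs_from x q'" "arcs_from y s"
    and "arcs_end y s = u" "x \<notin> e - {u}" "y = u \<or> x = u"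
  shows "card (merges e (if y = u then x else y) q' s) =
    (let M = (if y = u then n_visits u s else n_visits u s - 1)
     in (of_bool (x = u) + n_visits u q' + M - 1) choose M)"
  using assms(4-)
proof (induction "length q' + length s" arbitrary: q' s x y rule: less_induct)
  case less
  note IH = less.hyps and prems = less.prems
  have q'e: "\<forall>a\<in>set q'. arc_edge a \<noteq> e" using prems(1) assms(1) by auto
  have se: "\<forall>a\<in>set s. arc_edge a = e" using prems(2) by auto
  note unfold = merges_unfold[OF q'e se]
  have inj: "inj_on (Cons a) A" for a :: "'a arc" and A by auto
  \<comment> \<open>Taking an arc of \<open>s\<close> leaves \<open>n_visits u s - 1\<close>
    excursions to be started, whether that arc opens an excursion or continues one. The present
    visit to \<open>u\<close> stays available.\<close>
  have s_step: "card (merges e (arc_target (hd s)) q' (tl s)) =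
      (let M = n_visits u s - 1 in (of_bool (x = u) + n_visits u q' + M - 1) choose M)"
    if sx: "s \<noteq> []" "x = u"
  proof -
    obtain b d w s' where s: "s = (b, d, w) # s'" using sx(1) by (cases s) auto
    have "card (merges e (if w = u then u else w) q' s') =
        (let M = (if w = u then n_visits u s' else n_visits u s' - 1)
         in (of_bool (u = u) + n_visits u q' + M - 1) choose M)"
      by (rule IH) (use prems sx s in auto)
    then show ?thesis using s sx by (auto simp: Let_def split: if_splits)
  qed
  \<comment> \<open>Taking an arc of \<open>q'\<close> gives up the present visit to
    \<open>u\<close>, if there is one; only the arrivals of \<open>q'\<close> at \<open>u\<close>
    remain as slots.\<close>
  have q_step: "card (merges e (arc_target (hd q')) (tl q') s) =
      (let M = n_visits u s in (n_visits u q' + M - 1) choose M)"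
    if qy: "q' \<noteq> []" "y = u"
  proof -
    obtain b d w q'' where q': "q' = (b, d, w) # q''" using qy(1) by (cases q') auto
    have w: "w \<notin> e - {u}" using prems(1,3) q' assms(2)[of d] by auto
    have "card (merges e (if u = u then w else u) q'' s) =
        (let M = (if u = u then n_visits u s else n_visits u s - 1)
         in (of_bool (w = u) + n_visits u q'' + M - 1) choose M)"
      by (rule IH) (use prems qy q' w in auto)
    then show ?thesis using q' by simp
  qed
  show ?case
  proof (cases "y = u")
    case False
    then have x: "x = u" and s: "s \<noteq> []" using prems by auto
    have 1: "arcs_from y [hd s]" using s prems(4) by (cases s; cases "hd s") auto
    have 2: "\<not> (q' \<noteq> [] \<and> arcs_from y [hd q'])" using prems(3) x False by (cases q'; cases "hd q'") auto
    have "merges e y q' s = Cons (hd s) ` merges e (arc_target (hd s)) q' (tl s)"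
      unfolding unfold using s 1 2 by (auto split: if_splits)
    then show ?thesis using s_step[OF s x] False by (simp add: card_image[OF inj])
  next
    case y: True
    let ?A = "if q' \<noteq> [] then Cons (hd q') ` merges e (arc_target (hd q')) (tl q') s else {}"
    let ?B = "if s \<noteq> [] \<and> x = u then Cons (hd s) ` merges e (arc_target (hd s)) q' (tl s) else {}"
    have 1: "q' \<noteq> [] \<Longrightarrow> arcs_from x [hd q']" using prems(3) by (cases q'; cases "hd q'") auto
    have 2: "s \<noteq> [] \<Longrightarrow> arcs_from x [hd s] \<longleftrightarrow> x = u" using prems(4) y by (cases s; cases "hd s") auto
    have eq: "merges e x q' s = (if q' = [] \<and> s = [] then {[]} else {}) \<union> ?A \<union> ?B"
      unfolding unfold using 1 2 by (auto split: if_splits)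
    have hd_ne: "hd q' \<noteq> hd s" if "q' \<noteq> []" "s \<noteq> []"
      using that q'e se by (metis hd_in_set)
    have M: "n_visits u s > 0" if s0: "s \<noteq> []"
    proof -
      obtain b d w s' where s: "s = (b, d, w) # s'" using s0 by (cases s) auto
      then show ?thesis using n_visits_pos[of w s' u] prems(4,5) by (cases "w = u") auto
    qed
    show ?thesis
    proof (cases "q' = [] \<and> s = []")
      case True
      then show ?thesis using eq y by (auto simp: Let_def)
    next
      case False
      have "card (merges e x q' s) = card ?A + card ?B"
        unfolding eq using False hd_ne
        by (simp only: if_False Un_empty_left, subst card_Un_disjoint) (auto simp: finite_merges)
      also have "card ?A = (if q' = [] then 0 else (n_visits u q' + n_visits u s - 1) choose n_visits u s)" (is "_ = ?X")
        using q_step y by (simp add: card_image[OF inj] Let_def)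
      also have "card ?B = (if s \<noteq> [] \<and> x = u then (n_visits u q' + (n_visits u s - 1)) choose (n_visits u s - 1) else 0)" (is "_ = ?Y")
        using s_step by (simp add: card_image[OF inj] Let_def)
      finally have *: "card (merges e x q' s) = ?X + ?Y" .
      show ?thesis
      proof (cases "s = []")
        case True
        then show ?thesis using * False y by (simp add: Let_def)
      next
        case s: False
        obtain M where M: "n_visits u s = Suc M" using M[OF s] by (cases "n_visits u s") auto
        \<comment> \<open>Pascal's rule if \<open>x = u\<close>. For empty \<open>q'\<close> the
          binomial in \<open>?X\<close> would be \<open>M choose Suc M = 0\<close>, in agreement
          with the separate case there.\<close>
        show ?thesis using * s y M by (cases "q' = []") (auto simp: Let_def)
      qed
    qed
  qed
qed

lemma length_filter_partition:
  assumes "finite D" and "\<And>a. a \<in> set q \<Longrightarrow> Q a \<Longrightarrow> g a \<in> D"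
  shows "length (filter Q q) = (\<Sum>d\<in>D. length (filter (\<lambda>a. Q a \<and> g a = d) q))"
  using assms(2)
proof (induction q)
  case (Cons a q)
  have "length (filter (\<lambda>b. Q b \<and> g b = d) (a # q)) =
      (if Q a \<and> d = g a then 1 else 0) + length (filter (\<lambda>b. Q b \<and> g b = d) q)" for d
    by auto
  moreover have "(\<Sum>d\<in>D. if Q a \<and> d = g a then 1 else 0 :: nat) = (if Q a then 1 else 0)"
    using Cons.prems[of a] assms(1) by auto
  ultimately show ?case using Cons by (simp add: sum.distrib)
qed simp

text \<open>Each arrival at \<open>u\<close> comes out of exactly one hyperedge containing
  \<open>u\<close>, and each such hyperedge supplies \<open>m\<close> of them. The visit at the
  start is not an arrival and is counted separately where it matters.\<close>

lemma n_visits_circuit: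
  assumes q: "q \<in> circuits m E v" and "finite E"
  shows "n_visits u q = m * card {d\<in>E. u \<in> d}"
proof -
  have "n_visits u q = (\<Sum>d\<in>{d\<in>E. u \<in> d}. n_arr q u d)"
    unfolding n_visits_def n_arr_def
    by (rule length_filter_partition) (use assms arcs_fromD[of v q] in \<open>auto simp: circuits_def\<close>)
  also have "\<dots> = (\<Sum>d\<in>{d\<in>E. u \<in> d}. m)"
    by (rule sum.cong) (use q in \<open>auto simp: circuits_def\<close>)
  finally show ?thesis by (simp add: mult.commute)
qed

lemma n_dep_filter:
  "n_dep (filter (\<lambda>a. arc_edge a \<noteq> e) q) w d = (if d = e then 0 else n_dep q w d)"
  "n_dep (filter (\<lambda>a. arc_edge a = e) q) w d = (if d = e then n_dep q w d else 0)"
  "n_arr (filter (\<lambda>a. arc_edge a \<noteq> e) q) w d = (if d = e then 0 else n_arr q w d)"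
  "n_arr (filter (\<lambda>a. arc_edge a = e) q) w d = (if d = e then n_arr q w d else 0)"
  by (auto simp: n_dep_def n_arr_def intro!: arg_cong[where f = length] filter_cong filter_False)

text \<open>A circuit through \<open>insert e P\<close> is a circuit through \<open>P\<close> into which the \<open>m\<close> excursions from
  \<open>u\<close> into \<open>e\<close> have been inserted, each at one of the visits to \<open>u\<close>.\<close>

lemma card_circuits_insert:
  assumes fin: "finite P" "\<And>d. d \<in> insert e P \<Longrightarrow> finite d"
    and e: "e \<notin> P" "\<And>d. d \<in> P \<Longrightarrow> d \<inter> e \<subseteq> {u}" "u \<in> e" "v \<notin> e - {u}"
  shows "card (circuits m (insert e P) v) = card (circuits m P v) * card (circuits m {e} u) *
    ((of_bool (v = u) + m * card {d\<in>P. u \<in> d} + m - 1) choose m)"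
proof -
  let ?q' = "filter (\<lambda>a. arc_edge a \<noteq> e)" and ?s = "filter (\<lambda>a. arc_edge a = e)"
  let ?C = "circuits m P v \<times> circuits m {e} u"
  have sub: "arc_edge ` set q \<subseteq> insert e P \<longleftrightarrow> arc_edge ` set (?q' q) \<subseteq> P \<and> arc_edge ` set (?s q) \<subseteq> {e}"
    for q :: "'a arc list" using e(1) by auto
  have iff: "q \<in> circuits m (insert e P) v \<longleftrightarrow> arcs_from v q \<and> ?q' q \<in> circuits m P v \<and> ?s q \<in> circuits m {e} u" for q
  proof (cases "arcs_from v q \<and> arc_edge ` set q \<subseteq> insert e P")
    case True
    have ends: "arcs_from v (?q' q)" "arcs_from u (?s q)" "arcs_end u (?s q) \<in> e"
      "arcs_end v q = (if arcs_end u (?s q) = u then arcs_end v (?q' q) else arcs_end u (?s q))"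
      using arcs_split[OF e(1-3), of v q u v] True e(3,4) by auto
    \<comment> \<open>If the part in \<open>e\<close> ended away from \<open>u\<close>, the whole
      walk would end in \<open>e - {u}\<close>, where \<open>v\<close> does not lie.\<close>
    have closed: "arcs_end v q = v \<longleftrightarrow> arcs_end v (?q' q) = v \<and> arcs_end u (?s q) = u"
      using ends(3,4) e(4) by (auto split: if_splits)
    let ?N = "\<lambda>q D. \<forall>d\<in>D. \<forall>w\<in>d. n_dep q w d = m \<and> n_arr q w d = m"
    have N: "?N q (insert e P) \<longleftrightarrow> ?N (?q' q) P \<and> ?N (?s q) {e}"
    proof -
      have "d \<noteq> e" if "d \<in> P" for d using that e(1) by auto
      then have "?N (?q' q) P \<longleftrightarrow> ?N q P" by (intro ball_cong refl) (simp add: n_dep_filter)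
      moreover have "?N (?s q) {e} \<longleftrightarrow> ?N q {e}" by (simp add: n_dep_filter)
      ultimately show ?thesis by (simp add: conj_commute)
    qed
    have edges: "arc_edge ` set (?q' q) \<subseteq> P" "arc_edge ` set (?s q) \<subseteq> {e}"
      using True sub[of q] by simp_all
    have "q \<in> circuits m (insert e P) v \<longleftrightarrow> arcs_end v q = v \<and> ?N q (insert e P)"
      by (simp only: circuits_def mem_Collect_eq True simp_thms)
    moreover have "?q' q \<in> circuits m P v \<longleftrightarrow> arcs_end v (?q' q) = v \<and> ?N (?q' q) P"
      by (simp only: circuits_def mem_Collect_eq edges ends(1) simp_thms)
    moreover have "?s q \<in> circuits m {e} u \<longleftrightarrow> arcs_end u (?s q) = u \<and> ?N (?s q) {e}"
      by (simp only: circuits_def mem_Collect_eq edges ends(2) simp_thms)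
    ultimately show ?thesis using True closed N by metis
  next
    case False
    moreover have "q \<in> circuits m (insert e P) v \<Longrightarrow> arcs_from v q \<and> arc_edge ` set q \<subseteq> insert e P"
      "?q' q \<in> circuits m P v \<Longrightarrow> arc_edge ` set (?q' q) \<subseteq> P"
      "?s q \<in> circuits m {e} u \<Longrightarrow> arc_edge ` set (?s q) \<subseteq> {e}"
      unfolding circuits_def by blast+
    ultimately show ?thesis using sub[of q] by metis
  qed
  have "circuits m (insert e P) v = (\<Union>(q', s)\<in>?C. merges e v q' s)"
    using iff by (auto simp: merges_def)
  also have "card \<dots> = (\<Sum>(q', s)\<in>?C. card (merges e v q' s))"
    unfolding case_prod_unfold
  proof (rule card_UN_disjoint)
    show "finite ?C" using fin by (intro finite_cartesian_product finite_circuits) auto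
  qed (simp add: case_prod_unfold finite_merges, auto simp: merges_def)
  \<comment> \<open>The number of interleavings is the same for all pairs: the arrivals at
    \<open>u\<close> depend only on degrees, \<open>m\<close> in \<open>s\<close> and
    \<open>m\<close> in \<open>q'\<close> for each hyperedge of \<open>P\<close> at
    \<open>u\<close>.\<close>
  also have "\<dots> = (\<Sum>(q', s)\<in>?C. (of_bool (v = u) + m * card {d\<in>P. u \<in> d} + m - 1) choose m)"
  proof (intro sum.cong refl, clarify)
    fix q' s assume q': "q' \<in> circuits m P v" and s: "s \<in> circuits m {e} u"
    have *: "{d \<in> {e}. u \<in> d} = {e}" using e(3) by auto
    show "card (merges e v q' s) = (of_bool (v = u) + m * card {d\<in>P. u \<in> d} + m - 1) choose m"
      using card_merges[OF e(1-3), of q' s v u] q' s e(4) n_visits_circuit[OF q' fin(1), of u]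
        n_visits_circuit[OF s, of u] * by (simp add: circuits_def)
  qed
  also have "\<dots> = card (circuits m P v) * card (circuits m {e} u) *
    ((of_bool (v = u) + m * card {d\<in>P. u \<in> d} + m - 1) choose m)"
    by (simp add: case_prod_unfold card_cartesian_product)
  finally show ?thesis .
qed

section \<open>Invariance of the circuit count under relabelling\<close>

definition relabel_arc :: "('a \<Rightarrow> 'b) \<Rightarrow> 'a arc \<Rightarrow> 'b arc" where
  "relabel_arc g a = (g (fst a), g ` arc_edge a, g (arc_target a))"

lemma relabel_circuits:
  assumes inj: "inj_on g (insert v (\<Union>E))" and q: "q \<in> circuits m E v"
  shows "map (relabel_arc g) q \<in> circuits m ((`) g ` E) (g v)"
proof -
  have from_end: "arcs_from (g x) (map (relabel_arc g) p) \<and> arcs_end (g x) (map (relabel_arc g) p) = g (arcs_end x p)"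
    if "arcs_from x p" "arc_edge ` set p \<subseteq> E" for x p
    using that
  proof (induction x p rule: arcs_from.induct)
    case (2 v x e y q)
    then have "g x \<noteq> g y" using inj_onD[OF inj, of x y] by auto
    then show ?case using 2 by (auto simp: relabel_arc_def)
  qed simp
  have edges: "arc_edge a \<in> E" "fst a \<in> arc_edge a" "arc_target a \<in> arc_edge a" if "a \<in> set q" for a
    using q that arcs_fromD[of v q a] by (auto simp: circuits_def)
  have eq: "g x = g y \<longleftrightarrow> x = y" if "d \<in> E" "x \<in> d" "e \<in> E" "y \<in> e" for x y d e
    using inj_on_eq_iff[OF inj, of x y] that by auto
  have eq': "g ` d = g ` e \<longleftrightarrow> d = e" if "d \<in> E" "e \<in> E" for d e
    using inj_on_image_eq_iff[OF inj, of d e] that by blast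
  have "n_dep (map (relabel_arc g) q) (g u) (g ` e) = n_dep q u e \<and>
      n_arr (map (relabel_arc g) q) (g u) (g ` e) = n_arr q u e" if "e \<in> E" "u \<in> e" for e u
    unfolding n_dep_def n_arr_def filter_map length_map
    by (intro conjI arg_cong[where f = length] filter_cong refl)
      (use eq[OF edges(1,2) that] eq[OF edges(1,3) that] eq'[OF edges(1) that(1)] in \<open>auto simp: relabel_arc_def\<close>)
  then show ?thesis using q from_end[of v q] by (auto simp: circuits_def relabel_arc_def)
qed

lemma card_circuits_relabel_le:
  assumes inj: "inj_on g (insert v (\<Union>E))" and fin: "finite E" "\<And>e. e \<in> E \<Longrightarrow> finite e"
  shows "card (circuits m E v) \<le> card (circuits m ((`) g ` E) (g v))"
proof (rule card_inj_on_le)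
  show "map (relabel_arc g) ` circuits m E v \<subseteq> circuits m ((`) g ` E) (g v)"
    using relabel_circuits[OF inj] by blast
  show "finite (circuits m ((`) g ` E) (g v))" using fin by (intro finite_circuits) auto
  show "inj_on (map (relabel_arc g)) (circuits m E v)"
  proof (rule inj_onI)
    fix p q assume pq: "p \<in> circuits m E v" "q \<in> circuits m E v" "map (relabel_arc g) p = map (relabel_arc g) q"
    let ?A = "{a. arc_edge a \<in> E \<and> fst a \<in> arc_edge a \<and> arc_target a \<in> arc_edge a}"
    have "inj_on (relabel_arc g) ?A"
    proof (rule inj_onI)
      fix a b assume ab: "a \<in> ?A" "b \<in> ?A" "relabel_arc g a = relabel_arc g b"
      have "arc_edge a = arc_edge b"
        using inj_on_image_eq_iff[OF inj, of "arc_edge a" "arc_edge b"] ab by (auto simp: relabel_arc_def)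
      moreover have "fst a = fst b" "arc_target a = arc_target b"
        using inj_on_eq_iff[OF inj, of "fst a" "fst b"] inj_on_eq_iff[OF inj, of "arc_target a" "arc_target b"] ab
        by (auto simp: relabel_arc_def)
      ultimately show "a = b" by (simp add: prod_eq_iff)
    qed
    moreover have "set p \<subseteq> ?A" "set q \<subseteq> ?A"
      using pq arcs_fromD[of v p] arcs_fromD[of v q] by (auto simp: circuits_def)
    ultimately show "p = q" using pq(3) by (meson inj_on_map_eq_map inj_on_subset Un_least)
  qed
qed

text \<open>Used twice: the count for a single hyperedge depends only on its size, and isomorphic
  hypertrees have equal counts at corresponding vertices. The inverse of \<open>g\<close> supplies
  the reverse inequality.\<close>

lemma card_circuits_relabel:
  assumes inj: "inj_on g (insert v (\<Union>E))" and fin: "finite E" "\<And>e. e \<in> E \<Longrightarrow> finite e"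
  shows "card (circuits m ((`) g ` E) (g v)) = card (circuits m E v)"
proof (rule antisym)
  let ?i = "inv_into (insert v (\<Union>E)) g"
  have "?i ` g ` e = e" if "e \<in> E" for e
    using inv_into_image_cancel[OF inj, of e] that by auto
  then have 1: "(`) ?i ` (`) g ` E = E" by (force simp: image_iff)
  have 2: "?i (g v) = v" using inj by simp
  have "inj_on ?i (g ` insert v (\<Union>E))" by (rule inj_on_inv_into) simp
  then have "inj_on ?i (insert (g v) (\<Union>((`) g ` E)))" by (rule inj_on_subset) auto
  then show "card (circuits m ((`) g ` E) (g v)) \<le> card (circuits m E v)"
    using card_circuits_relabel_le[of ?i "g v" "(`) g ` E" m] fin 1 2 by auto
qed (rule card_circuits_relabel_le[OF assms])

section \<open>Rooted hyperforests\<close>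

definition hadj :: "'a set set \<Rightarrow> ('a \<times> 'a) set" where
  "hadj E = {(x, y). \<exists>e\<in>E. x \<in> e \<and> y \<in> e}"

text \<open>Given that every vertex is reachable from a root, \<open>card U = r * card E\<close> expresses that the
  hypergraph is a forest with exactly one root in each component.\<close>

definition hforests :: "nat \<Rightarrow> 'a set \<Rightarrow> 'a set \<Rightarrow> 'a set set set" where
  "hforests r R U = {E. (\<forall>e\<in>E. e \<subseteq> R \<union> U \<and> card e = r + 1) \<and> card U = r * card E \<and>
     U \<subseteq> (hadj E)\<^sup>* `` R}"

text \<open>The shape of a neighbourhood in a forest: removing the root \<open>a\<close> from the
  \<open>d\<close> hyperedges through it leaves \<open>d\<close> disjoint \<open>r\<close>-sets of
  non-roots.\<close>

definition packings :: "nat \<Rightarrow> nat \<Rightarrow> 'a set \<Rightarrow> 'a set set set" where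
  "packings r d U = {D. D \<subseteq> Pow U \<and> card D = d \<and> (\<forall>X\<in>D. card X = r) \<and> pairwise disjnt D}"

lemma finite_hforests:
  assumes "finite (R \<union> U)" shows "finite (hforests r R U)"
proof (rule finite_subset)
  show "hforests r R U \<subseteq> Pow (Pow (R \<union> U))" by (auto simp: hforests_def)
qed (use assms in simp)

lemma finite_packings: "finite U \<Longrightarrow> finite (packings r d U)"
  by (rule finite_subset[of _ "Pow (Pow U)"]) (auto simp: packings_def)

section \<open>Peeling a root off a forest\<close>

text \<open>After its last hyperedge through \<open>a\<close>, a path to \<open>x\<close> uses only
  hyperedges avoiding \<open>a\<close>, and it leaves that last one at a neighbour of
  \<open>a\<close>, which now counts as a root.\<close>

lemma reach_peel:
  assumes "x \<in> (hadj E)\<^sup>* `` R" and "x \<noteq> a"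
  shows "x \<in> (hadj {e\<in>E. a \<notin> e})\<^sup>* `` ((R - {a}) \<union> (\<Union>{e\<in>E. a \<in> e} - {a}))"
proof -
  obtain b where "b \<in> R" "(b, x) \<in> (hadj E)\<^sup>*" using assms(1) by auto
  from this(2,1) assms(2) show ?thesis
  proof (induction rule: rtrancl_induct)
    case (step y z)
    obtain e where e: "e \<in> E" "y \<in> e" "z \<in> e" using step.hyps(2) by (auto simp: hadj_def)
    show ?case
    proof (cases "a \<in> e")
      case True
      then show ?thesis using e step.prems by blast
    next
      case False
      then have "(y, z) \<in> hadj {e\<in>E. a \<notin> e}" "y \<noteq> a" using e by (auto simp: hadj_def)
      then show ?thesis using step.IH step.prems by (meson Image_iff rtrancl.rtrancl_into_rtrancl)
    qed
  qed auto
qed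

lemma card_Union_inter_le:
  assumes "finite A" "\<And>e. e \<in> A \<Longrightarrow> card (e \<inter> U) \<le> r"
  shows "card (\<Union>A \<inter> U) \<le> r * card A"
  using assms
proof (induction A)
  case (insert e A)
  have "card (\<Union>(insert e A) \<inter> U) \<le> card (e \<inter> U) + card (\<Union>A \<inter> U)"
    using card_Un_le[of "e \<inter> U" "\<Union>A \<inter> U"] by (simp add: Int_Un_distrib2)
  also have "\<dots> \<le> r + r * card A" using insert by (intro add_mono) auto
  finally show ?case using insert.hyps by simp
qed simp

lemma card_diff_root:
  assumes "card e = r + 1" "a \<in> e" "a \<notin> U"
  shows "card (e \<inter> U) \<le> r"
proof -
  have "finite e" using assms(1) by (metis card.infinite add_is_0 one_neq_zero)
  then have "card (e \<inter> U) \<le> card (e - {a})" using assms(3) by (intro card_mono) auto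
  then show ?thesis using assms by simp
qed

text \<open>A hyperedge is entered through a vertex reached before, so it adds at most
  \<open>r\<close> new ones. This is the analogue of the lower bound on the number of edges of a
  connected graph; forests are its case of equality.\<close>

lemma card_reached_le:
  assumes "finite (R \<union> U)" "R \<inter> U = {}" "\<And>e. e \<in> E \<Longrightarrow> e \<subseteq> R \<union> U \<and> card e = r + 1"
    and "U \<subseteq> (hadj E)\<^sup>* `` R"
  shows "card U \<le> r * card E"
  using assms
proof (induction "card (R \<union> U)" arbitrary: R U E rule: less_induct)
  case less
  have finE: "finite E"
    using less.prems(1,3) by (intro finite_subset[of E "Pow (R \<union> U)"]) auto
  show ?case
  proof (cases "R = {}")
    case True
    then show ?thesis using less.prems(4) by auto
  next
    case False
    then obtain a where a: "a \<in> R" by auto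
    let ?E1 = "{e\<in>E. a \<in> e}" and ?E2 = "{e\<in>E. a \<notin> e}"
    let ?R' = "(R - {a}) \<union> (\<Union>?E1 - {a})" and ?U' = "U - \<Union>?E1"
    have aU: "a \<notin> U" using a less.prems(2) by auto
    have RU: "?R' \<union> ?U' = (R \<union> U) - {a}" using less.prems(3) aU by auto
    have "card ?U' \<le> r * card ?E2"
    proof (rule less.hyps)
      show "card (?R' \<union> ?U') < card (R \<union> U)"
        unfolding RU using less.prems(1) a by (intro psubset_card_mono) auto
      show "finite (?R' \<union> ?U')" unfolding RU using less.prems(1) by simp
      show "?R' \<inter> ?U' = {}" using less.prems(2) by auto
      show "e \<subseteq> ?R' \<union> ?U' \<and> card e = r + 1" if "e \<in> ?E2" for e
        unfolding RU using less.prems(3) that by auto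
      show "?U' \<subseteq> (hadj ?E2)\<^sup>* `` ?R'"
      proof
        fix x assume "x \<in> ?U'"
        then have "x \<in> (hadj E)\<^sup>* `` R" "x \<noteq> a" using less.prems(4) aU by auto
        then show "x \<in> (hadj ?E2)\<^sup>* `` ?R'" by (rule reach_peel)
      qed
    qed
    moreover have "card (\<Union>?E1 \<inter> U) \<le> r * card ?E1"
      by (rule card_Union_inter_le) (use finE less.prems(3) aU in \<open>auto intro!: card_diff_root\<close>)
    moreover have "card U = card ?U' + card (\<Union>?E1 \<inter> U)"
      using less.prems(1) card_Int_Diff[of U "\<Union>?E1"] by (simp add: Int_commute)
    moreover have "card E = card ?E2 + card ?E1"
      using finE by (subst card_Un_disjoint[symmetric]) (auto intro: arg_cong[where f = card])
    ultimately show ?thesis by (simp add: algebra_simps)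
  qed
qed

text \<open>The case of equality in the union bound: neither a smaller set nor an overlap can be
  afforded.\<close>

lemma card_UN_ge_imp_disjnt:
  assumes "finite A" "\<And>e. e \<in> A \<Longrightarrow> finite (f e) \<and> card (f e) \<le> r" "r * card A \<le> card (\<Union>(f ` A))"
  shows "(\<forall>e\<in>A. card (f e) = r) \<and> pairwise (\<lambda>e e'. disjnt (f e) (f e')) A"
  using assms
proof (induction A)
  case (insert e A)
  let ?V = "\<Union>(f ` A)"
  have fin: "finite (f e)" "finite ?V" using insert.prems(1) insert.hyps(1) by auto
  have le: "card (f e) \<le> r" using insert.prems(1) by simp
  have V: "card ?V \<le> r * card A"
    using card_UN_le[OF insert.hyps(1), of f] sum_bounded_above[of A "\<lambda>e. card (f e)" r] insert.prems(1)
    by (auto simp: mult.commute intro: order_trans)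
  have "card (f e \<union> ?V) \<ge> r + r * card A" using insert.prems(2) insert.hyps by simp
  moreover have "card (f e) + card ?V = card (f e \<union> ?V) + card (f e \<inter> ?V)"
    by (rule card_Un_Int[OF fin])
  ultimately have "card (f e) = r" "r * card A \<le> card ?V" "card (f e \<inter> ?V) = 0"
    using V le by linarith+
  moreover from this(3) have "f e \<inter> ?V = {}" using fin by simp
  ultimately show ?case
    using insert.IH insert.prems(1) by (auto simp: pairwise_insert disjnt_def)
qed simp

lemma card_Union_packing:
  assumes "D \<in> packings r d U" "finite U"
  shows "card (\<Union>D) = r * d"
proof -
  have "card (\<Union>D) = (\<Sum>X\<in>D. card X)"
    using assms by (intro card_Union_disjoint) (auto simp: packings_def intro: finite_subset)
  then show ?thesis using assms by (simp add: packings_def)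
qed

text \<open>Counting forces the forest structure. By \<open>card_reached_le\<close> the hyperedges
  avoiding \<open>a\<close> account for at least as many vertices as remain in \<open>U\<close>
  outside the neighbourhood of \<open>a\<close>. Since \<open>card U = r * card E\<close>, the
  hyperedges at \<open>a\<close> must therefore contribute \<open>r\<close> vertices of
  \<open>U\<close> each, without overlap.\<close>

lemma hforests_peel:
  assumes fin: "finite (R \<union> U)" and RU: "R \<inter> U = {}" and a: "a \<in> R" and E: "E \<in> hforests r R U"
  defines "D \<equiv> (\<lambda>e. e - {a}) ` {e\<in>E. a \<in> e}" and "E2 \<equiv> {e\<in>E. a \<notin> e}"
  shows "D \<in> packings r (card D) U" and "E2 \<in> hforests r ((R - {a}) \<union> \<Union>D) (U - \<Union>D)"
    and "insert a ` D \<union> E2 = E"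
proof -
  let ?E1 = "{e\<in>E. a \<in> e}"
  have aU: "a \<notin> U" using a RU by auto
  have E': "\<And>e. e \<in> E \<Longrightarrow> e \<subseteq> R \<union> U \<and> card e = r + 1" "card U = r * card E" "U \<subseteq> (hadj E)\<^sup>* `` R"
    using E by (auto simp: hforests_def)
  have finE: "finite E" using E'(1) fin by (intro finite_subset[of E "Pow (R \<union> U)"]) auto
  have UD: "\<Union>D = \<Union>?E1 - {a}" by (auto simp: D_def)
  let ?R' = "(R - {a}) \<union> \<Union>D" and ?U' = "U - \<Union>D"
  have RU': "?R' \<union> ?U' = (R \<union> U) - {a}" using E'(1) aU UD by auto
  have edges: "e \<subseteq> ?R' \<union> ?U' \<and> card e = r + 1" if "e \<in> E2" for e
    unfolding RU' using E'(1) that by (auto simp: E2_def)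
  have reach: "?U' \<subseteq> (hadj E2)\<^sup>* `` ?R'"
  proof
    fix x assume "x \<in> ?U'"
    then have "x \<in> (hadj E)\<^sup>* `` R" "x \<noteq> a" using E'(3) aU by auto
    then show "x \<in> (hadj E2)\<^sup>* `` ?R'" unfolding UD E2_def by (rule reach_peel)
  qed
  have "card ?U' \<le> r * card E2"
  proof (rule card_reached_le[OF _ _ edges reach])
    show "finite (?R' \<union> ?U')" unfolding RU' using fin by simp
    show "?R' \<inter> ?U' = {}" using RU by auto
  qed
  moreover have cE: "card E = card E2 + card ?E1"
    unfolding E2_def using finE by (subst card_Un_disjoint[symmetric]) (auto intro: arg_cong[where f = card])
  moreover have cU: "card U = card ?U' + card (\<Union>((\<lambda>e. e \<inter> U) ` ?E1))"
    using fin aU UD by (subst card_Un_disjoint[symmetric]) (auto intro!: arg_cong[where f = card])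
  ultimately have ge: "r * card ?E1 \<le> card (\<Union>((\<lambda>e. e \<inter> U) ` ?E1))"
    using E'(2) by (simp add: algebra_simps)
  have full: "(\<forall>e\<in>?E1. card (e \<inter> U) = r) \<and> pairwise (\<lambda>e e'. disjnt (e \<inter> U) (e' \<inter> U)) ?E1"
    by (rule card_UN_ge_imp_disjnt[OF _ _ ge])
      (use finE fin E'(1) aU in \<open>auto intro!: card_diff_root\<close>)
  \<comment> \<open>No second root fits into \<open>e\<close>: its intersection with
    \<open>U\<close> already has the size of \<open>e - {a}\<close>.\<close>
  have eU: "e - {a} = e \<inter> U" if e: "e \<in> E" "a \<in> e" for e
  proof -
    have "finite e" using E'(1)[OF e(1)] fin by (meson finite_subset)
    moreover have "card (e - {a}) = r" using E'(1)[OF e(1)] e(2) by simp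
    moreover have "card (e \<inter> U) = r" using full e by blast
    ultimately show ?thesis using aU by (intro card_subset_eq[symmetric]) auto
  qed
  show D: "D \<in> packings r (card D) U"
    unfolding packings_def
  proof (intro CollectI conjI ballI)
    show "D \<subseteq> Pow U" using eU by (auto simp: D_def)
    show "card X = r" if "X \<in> D" for X using that full eU by (auto simp: D_def)
    show "pairwise disjnt D"
      unfolding D_def pairwise_image
    proof (rule pairwiseI, rule impI)
      fix e e' assume ee: "e \<in> ?E1" "e' \<in> ?E1" "e \<noteq> e'"
      then have "disjnt (e \<inter> U) (e' \<inter> U)" using full by (auto simp: pairwise_def)
      then show "disjnt (e - {a}) (e' - {a})" using ee eU by auto
    qed
  qed simp
  have "inj_on (\<lambda>e. e - {a}) ?E1" by (rule inj_onI) blast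
  then have "card D = card ?E1" unfolding D_def by (rule card_image)
  then have cD: "card (\<Union>D) = r * card ?E1" using card_Union_packing[OF D] fin by simp
  have "\<Union>D \<subseteq> U" using D by (auto simp: packings_def)
  then have "card ?U' = card U - card (\<Union>D)" using fin by (intro card_Diff_subset) (auto intro: finite_subset)
  then have "card ?U' = r * card E2" using cD cE E'(2) by (simp add: algebra_simps)
  then show "E2 \<in> hforests r ?R' ?U'" using edges reach by (simp add: hforests_def)
  show "insert a ` D \<union> E2 = E" unfolding D_def E2_def by (auto simp: image_image insert_absorb)
qed

text \<open>The inverse of \<open>hforests_peel\<close>: the packing at \<open>a\<close> and the
  forest hanging from the other roots and the packed vertices can be chosen freely, since vertices
  and hyperedges add up and everything stays reachable through \<open>a\<close>.\<close>

lemma hforests_attach: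
  assumes fin: "finite (R \<union> U)" and RU: "R \<inter> U = {}" and a: "a \<in> R" and D: "D \<in> packings r d U"
    and E2: "E2 \<in> hforests r ((R - {a}) \<union> \<Union>D) (U - \<Union>D)"
  shows "insert a ` D \<union> E2 \<in> hforests r R U"
    and "(\<lambda>e. e - {a}) ` {e \<in> insert a ` D \<union> E2. a \<in> e} = D" and "{e \<in> insert a ` D \<union> E2. a \<notin> e} = E2"
proof -
  let ?R' = "(R - {a}) \<union> \<Union>D" and ?U' = "U - \<Union>D" and ?E = "insert a ` D \<union> E2"
  have aU: "a \<notin> U" using a RU by auto
  have DU: "\<Union>D \<subseteq> U" using D by (auto simp: packings_def)
  have E2': "\<And>e. e \<in> E2 \<Longrightarrow> e \<subseteq> ?R' \<union> ?U' \<and> card e = r + 1" "card ?U' = r * card E2" "?U' \<subseteq> (hadj E2)\<^sup>* `` ?R'"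
    using E2 by (auto simp: hforests_def)
  have aE2: "a \<notin> e" if "e \<in> E2" for e using E2'(1)[OF that] aU DU by blast
  have aD: "a \<notin> X" if "X \<in> D" for X using that aU DU by auto
  show "{e \<in> ?E. a \<notin> e} = E2" using aE2 by auto
  have "{e \<in> ?E. a \<in> e} = insert a ` D" using aE2 by auto
  then show "(\<lambda>e. e - {a}) ` {e \<in> ?E. a \<in> e} = D" using aD by (simp add: image_image)
  have inj: "inj_on (insert a) D" using aD by (intro inj_onI) (metis insert_ident)
  have finD: "finite D" using DU fin by (meson finite_UnionD finite_subset finite_Un)
  have finE2: "finite E2" using E2'(1) fin DU by (intro finite_subset[of E2 "Pow (R \<union> U)"]) auto
  have "card ?E = card D + card E2"
    using card_Un_disjoint[of "insert a ` D" E2] finD finE2 aE2 card_image[OF inj] by auto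
  moreover have "card ?U' = card U - card (\<Union>D)" using fin DU by (intro card_Diff_subset) (auto intro: finite_subset)
  moreover have "card (\<Union>D) = r * card D" using card_Union_packing[OF D] fin D by (simp add: packings_def)
  moreover have "card (\<Union>D) \<le> card U" using fin DU by (intro card_mono) auto
  ultimately have cU: "card U = r * card ?E" using E2'(2) by (simp add: algebra_simps)
  have edges: "e \<subseteq> R \<union> U \<and> card e = r + 1" if e: "e \<in> ?E" for e
  proof (cases "e \<in> E2")
    case True
    then show ?thesis using E2'(1) DU by blast
  next
    case False
    then obtain X where X: "X \<in> D" "e = insert a X" using e by auto
    then have "finite X" using DU fin by (meson Union_upper finite_Un finite_subset)
    then show ?thesis using X aD[OF X(1)] D a DU by (auto simp: packings_def)
  qed
  have reach_D: "x \<in> (hadj ?E)\<^sup>* `` R" if x: "x \<in> ?R'" for x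
  proof (cases "x \<in> R")
    case False
    then obtain X where "X \<in> D" "x \<in> X" using x by auto
    then have "(a, x) \<in> hadj ?E" by (auto simp: hadj_def)
    then show ?thesis using a by auto
  qed auto
  have mono: "(hadj E2)\<^sup>* \<subseteq> (hadj ?E)\<^sup>*" by (rule rtrancl_mono) (auto simp: hadj_def)
  have "x \<in> (hadj ?E)\<^sup>* `` R" if x: "x \<in> U" for x
  proof (cases "x \<in> \<Union>D")
    case True
    then show ?thesis using reach_D by blast
  next
    case False
    then obtain b where "b \<in> ?R'" "(b, x) \<in> (hadj E2)\<^sup>*" using x E2'(3) by blast
    moreover from this obtain b' where "b' \<in> R" "(b', b) \<in> (hadj ?E)\<^sup>*" using reach_D by blast
    ultimately show ?thesis using mono by (meson ImageI rtrancl_trans subsetD)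
  qed
  then show "?E \<in> hforests r R U" using edges cU unfolding hforests_def by blast
qed

text \<open>Splits the forests by what hangs at \<open>a\<close>. The range of \<open>d\<close> ends
  at \<open>n\<close> because \<open>d\<close> disjoint \<open>r\<close>-sets must fit into
  \<open>U\<close>.\<close>

lemma sum_hforests_peel:
  fixes g :: "'a set set \<Rightarrow> 'b::comm_monoid_add"
  assumes fin: "finite (R \<union> U)" and RU: "R \<inter> U = {}" and a: "a \<in> R"
    and n: "card U = r * n" and r: "r \<ge> 1"
  shows "(\<Sum>E\<in>hforests r R U. g E) =
    (\<Sum>d\<le>n. \<Sum>D\<in>packings r d U. \<Sum>E2\<in>hforests r ((R - {a}) \<union> \<Union>D) (U - \<Union>D). g (insert a ` D \<union> E2))"
proof -
  let ?F = "\<lambda>D. hforests r ((R - {a}) \<union> \<Union>D) (U - \<Union>D)"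
  let ?P = "\<Union>d\<in>{..n}. packings r d U"
  have le: "d \<le> n" if D: "D \<in> packings r d U" for d D
  proof -
    have "\<Union>D \<subseteq> U" using D by (auto simp: packings_def)
    then have "r * d \<le> r * n" using card_mono[of U "\<Union>D"] fin n card_Union_packing[OF D] by simp
    then show ?thesis using r by simp
  qed
  have "bij_betw (\<lambda>(D, E2). insert a ` D \<union> E2) (Sigma ?P ?F) (hforests r R U)"
  proof (rule bij_betw_byWitness[where f' = "\<lambda>E. ((\<lambda>e. e - {a}) ` {e\<in>E. a \<in> e}, {e\<in>E. a \<notin> e})"])
    show "\<forall>p\<in>Sigma ?P ?F. (\<lambda>E. ((\<lambda>e. e - {a}) ` {e\<in>E. a \<in> e}, {e\<in>E. a \<notin> e})) ((\<lambda>(D, E2). insert a ` D \<union> E2) p) = p"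
      using hforests_attach(2,3)[OF fin RU a] by fastforce
    show "\<forall>E\<in>hforests r R U. (\<lambda>(D, E2). insert a ` D \<union> E2) ((\<lambda>e. e - {a}) ` {e\<in>E. a \<in> e}, {e\<in>E. a \<notin> e}) = E"
      using hforests_peel(3)[OF fin RU a] by simp
    show "(\<lambda>(D, E2). insert a ` D \<union> E2) ` Sigma ?P ?F \<subseteq> hforests r R U"
      using hforests_attach(1)[OF fin RU a] by auto
    show "(\<lambda>E. ((\<lambda>e. e - {a}) ` {e\<in>E. a \<in> e}, {e\<in>E. a \<notin> e})) ` hforests r R U \<subseteq> Sigma ?P ?F"
    proof (rule image_subsetI)
      fix E assume E: "E \<in> hforests r R U"
      note peel = hforests_peel(1,2)[OF fin RU a E]
      show "((\<lambda>e. e - {a}) ` {e\<in>E. a \<in> e}, {e\<in>E. a \<notin> e}) \<in> Sigma ?P ?F"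
        using peel le[OF peel(1)] by (intro SigmaI UN_I) auto
    qed
  qed
  then have "(\<Sum>E\<in>hforests r R U. g E) = (\<Sum>(D, E2)\<in>Sigma ?P ?F. g (insert a ` D \<union> E2))"
    by (subst sum.reindex_bij_betw[symmetric]) (auto simp: case_prod_unfold)
  also have "\<dots> = (\<Sum>D\<in>?P. \<Sum>E2\<in>?F D. g (insert a ` D \<union> E2))"
  proof (rule sum.Sigma[symmetric])
    show "finite ?P" using fin by (simp add: finite_packings)
    show "\<forall>D\<in>?P. finite (?F D)"
    proof
      fix D assume "D \<in> ?P"
      then have "\<Union>D \<subseteq> U" by (auto simp: packings_def)
      then show "finite (?F D)" using fin by (intro finite_hforests) (auto intro: finite_subset)
    qed
  qed
  also have "\<dots> = (\<Sum>d\<le>n. \<Sum>D\<in>packings r d U. \<Sum>E2\<in>?F D. g (insert a ` D \<union> E2))"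
    using fin by (intro sum.UNION_disjoint) (auto simp: finite_packings, auto simp: packings_def)
  finally show ?thesis .
qed

text \<open>A multinomial count, written as a product to avoid division. The induction counts pairs
  of a packing and a distinguished block in two ways: choose the block first and pack the rest, or
  choose one of the \<open>Suc d\<close> blocks of a packing.\<close>

lemma card_packings:
  assumes r: "r \<ge> 1" and "finite U" "r * d \<le> card U"
  shows "card (packings r d U) * (fact r ^ d * fact d * fact (card U - r * d)) = (fact (card U) :: nat)"
  using assms(2,3)
proof (induction d arbitrary: U)
  case 0
  have "packings r 0 U = {{}}"
    using \<open>finite U\<close> by (auto simp: packings_def card_eq_0_iff dest: finite_subset[of _ "Pow U"])
  then show ?case by simp
next
  case (Suc d)
  let ?S = "{X\<in>Pow U. card X = r}"
  have le: "r \<le> card U" "r * d \<le> card U - r" using Suc.prems(2) by auto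
  have fin: "finite (packings r (Suc d) U)" using Suc.prems by (simp add: finite_packings)
  have fin': "finite D" "finite (\<Union>D)" if "D \<in> packings r k U" for D k
  proof -
    have "D \<subseteq> Pow U" using that by (simp add: packings_def)
    moreover from this have "\<Union>D \<subseteq> U" by blast
    ultimately show "finite D" "finite (\<Union>D)"
      using Suc.prems(1) by (meson finite_Pow_iff finite_subset)+
  qed
  \<comment> \<open>Blocks are nonempty as \<open>r\<close> is positive, so a block \<open>X\<close>
    cannot reappear in a packing of \<open>U - X\<close>.\<close>
  have notin: "X \<notin> D" if D: "D \<in> packings r d (U - X)" and X: "card X = r" for X D
  proof
    assume "X \<in> D"
    then have "X \<subseteq> U - X" using D by (auto simp: packings_def)
    then have "X = {}" by blast
    then show False using X r by simp
  qed
  have "bij_betw (\<lambda>(X, D). (insert X D, X)) (SIGMA X:?S. packings r d (U - X)) (SIGMA D:packings r (Suc d) U. D)"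
  proof (rule bij_betw_byWitness[where f' = "\<lambda>(D, X). (X, D - {X})"])
    show "\<forall>p\<in>SIGMA X:?S. packings r d (U - X). (\<lambda>(D, X). (X, D - {X})) ((\<lambda>(X, D). (insert X D, X)) p) = p"
      using notin by auto
    show "\<forall>p\<in>SIGMA D:packings r (Suc d) U. D. (\<lambda>(X, D). (insert X D, X)) ((\<lambda>(D, X). (X, D - {X})) p) = p"
      by auto
    show "(\<lambda>(X, D). (insert X D, X)) ` (SIGMA X:?S. packings r d (U - X)) \<subseteq> (SIGMA D:packings r (Suc d) U. D)"
    proof clarify
      fix X D assume X: "X \<subseteq> U" "r = card X" and D: "D \<in> packings (card X) d (U - X)"
      have "X \<notin> D" using notin D X by blast
      moreover have "finite D" using D Suc.prems(1) finite_subset[of D "Pow U"] by (auto simp: packings_def)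
      ultimately show "insert X D \<in> packings (card X) (Suc d) U \<and> X \<in> insert X D"
        using D X by (auto simp: packings_def pairwise_insert disjnt_def)
    qed
    show "(\<lambda>(D, X). (X, D - {X})) ` (SIGMA D:packings r (Suc d) U. D) \<subseteq> (SIGMA X:?S. packings r d (U - X))"
    proof clarify
      fix X D assume D: "D \<in> packings r (Suc d) U" and X: "X \<in> D"
      have "Y \<inter> X = {}" if "Y \<in> D" "Y \<noteq> X" for Y
        using D X that by (auto simp: packings_def pairwise_def disjnt_def)
      moreover have "pairwise disjnt (D - {X})" using D by (auto simp: packings_def pairwise_def)
      ultimately show "X \<in> ?S \<and> D - {X} \<in> packings r d (U - X)"
        using D X fin'(1)[OF D] by (auto simp: packings_def)
    qed
  qed
  then have "card (SIGMA X:?S. packings r d (U - X)) = card (SIGMA D:packings r (Suc d) U. D)"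
    by (rule bij_betw_same_card)
  also have "\<dots> = (\<Sum>D\<in>packings r (Suc d) U. card D)"
    using fin fin'(1) by (intro card_SigmaI) auto
  also have "\<dots> = Suc d * card (packings r (Suc d) U)" by (simp add: packings_def)
  finally have 1: "(\<Sum>X\<in>?S. card (packings r d (U - X))) = Suc d * card (packings r (Suc d) U)"
    using Suc.prems(1) by (subst (asm) card_SigmaI) (auto simp: finite_packings)
  let ?k = "fact r ^ d * fact d * fact (card U - r * Suc d) :: nat"
  have "card (packings r d (U - X)) * ?k = fact (card U - r)" if "X \<in> ?S" for X
  proof -
    have c: "card (U - X) = card U - r"
      using that Suc.prems(1) by (auto intro: card_Diff_subset finite_subset)
    then show ?thesis using Suc.IH[of "U - X"] Suc.prems(1) le by (simp add: c)
  qed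
  then have "(\<Sum>X\<in>?S. card (packings r d (U - X)) * ?k) = card ?S * fact (card U - r)"
    by simp
  then have "Suc d * card (packings r (Suc d) U) * ?k = (card U choose r) * fact (card U - r)"
    unfolding sum_distrib_right[symmetric] 1 using n_subsets[OF Suc.prems(1), of r]
    by (simp add: Pow_def conj_commute)
  then have "fact r * (Suc d * card (packings r (Suc d) U) * ?k) = fact (card U)"
    using binomial_fact_lemma[OF le(1)] by (simp add: algebra_simps)
  then show ?case by (simp add: algebra_simps)
qed

section \<open>Weighted enumeration\<close>

lemma fps_compose_mult_nth:
  fixes f :: "'a::comm_ring_1 fps"
  assumes "f $ 0 = 0"
  shows "((g oo f) * H) $ n = (\<Sum>d\<le>n. g $ d * (f ^ d * H) $ n)"
proof -
  \<comment> \<open>Each inner sum may be extended up to \<open>n\<close>, because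
    \<open>f ^ d\<close> has no coefficient below degree \<open>d\<close>.\<close>
  have "((g oo f) * H) $ n = (\<Sum>i\<le>n. \<Sum>d\<le>n. g $ d * (f ^ d) $ i * H $ (n - i))"
    unfolding fps_mult_nth fps_compose_nth sum_distrib_right atLeast0AtMost
    using startsby_zero_power_prefix[OF assms]
    by (intro sum.cong sum.mono_neutral_left refl) auto
  also have "\<dots> = (\<Sum>d\<le>n. g $ d * (f ^ d * H) $ n)"
    unfolding fps_mult_nth atLeast0AtMost
    by (subst sum.swap) (simp add: sum_distrib_left mult.assoc)
  finally show ?thesis .
qed

text \<open>The equation gives \<open>f ^ d * L ^ k = fps_X ^ d * L ^ (k + r * d)\<close>. Read on
  forests: one root is peeled off, \<open>k\<close> others stay, its \<open>d\<close> hyperedges are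
  used up and bring in \<open>r * d\<close> new roots.\<close>

lemma fps_fixpoint_mult_nth:
  fixes f :: "'a::comm_ring_1 fps"
  assumes f: "f = fps_X * L ^ r"
  shows "((g oo f) * L ^ k) $ n = (\<Sum>d\<le>n. g $ d * L ^ (k + r * d) $ (n - d))"
proof -
  have "f $ 0 = 0" by (subst f) simp
  moreover have "(f ^ d * L ^ k) $ n = L ^ (k + r * d) $ (n - d)" if "d \<le> n" for d
  proof -
    have "f ^ d * L ^ k = fps_X ^ d * L ^ (k + r * d)"
      by (subst f) (simp add: power_mult_distrib power_mult[symmetric] power_add mult_ac)
    then show ?thesis using that by (simp add: fps_X_power_mult_nth)
  qed
  ultimately show ?thesis by (subst fps_compose_mult_nth) auto
qed

lemma binomial_fact_add: "((m + k) choose m) * (fact m * fact k) = (fact (m + k) :: nat)"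
  using binomial_fact_lemma[of m "m + k"] by (simp add: mult_ac)

text \<open>Factor \<open>i\<close> belongs to the start vertex with \<open>i\<close> hyperedges
  attached, hence \<open>1 + m * i\<close> visits. It equals
  \<open>(m * i + m)! / (m! * (m * i)!)\<close>, so the product telescopes.\<close>

lemma prod_binomial_root: "(\<Prod>i<d. (1 + m * i + m - 1) choose m) * fact m ^ d = (fact (d * m) :: nat)"
proof (induction d)
  case (Suc d)
  let ?B = "(1 + m * d + m - 1) choose m"
  have B: "?B * (fact m * fact (d * m)) = (fact (Suc d * m) :: nat)"
    using binomial_fact_add[of m "d * m"] by (simp add: mult.commute add.commute)
  have "(\<Prod>i<Suc d. (1 + m * i + m - 1) choose m) * fact m ^ Suc d =
      ?B * (fact m * ((\<Prod>i<d. (1 + m * i + m - 1) choose m) * fact m ^ d))"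
    by (simp only: prod.lessThan_Suc power_Suc mult_ac)
  then show ?case unfolding Suc.IH B .
qed simp

text \<open>Here the hyperedge towards the root supplies \<open>m\<close> visits in place of the
  start. The product telescopes down to \<open>fact (m - 1)\<close>, which is the source of the
  \<open>m - 1\<close> in \<open>lam m\<close>.\<close>

lemma prod_binomial_nonroot:
  assumes "m \<ge> 1"
  shows "(\<Prod>i<d. (m * (1 + i) + m - 1) choose m) * fact m ^ d * fact (m - 1) = (fact (m - 1 + d * m) :: nat)"
proof (induction d)
  case (Suc d)
  let ?B = "(m * (1 + d) + m - 1) choose m"
  have "m * (1 + d) + m - 1 = m + (m - 1 + d * m)" "m - 1 + Suc d * m = m + (m - 1 + d * m)"
    using assms by (auto simp: algebra_simps)
  then have B: "?B * (fact m * fact (m - 1 + d * m)) = (fact (m - 1 + Suc d * m) :: nat)"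
    using binomial_fact_add[of m "m - 1 + d * m"] by (simp only:)
  have "(\<Prod>i<Suc d. (m * (1 + i) + m - 1) choose m) * fact m ^ Suc d * fact (m - 1) =
      ?B * (fact m * ((\<Prod>i<d. (m * (1 + i) + m - 1) choose m) * fact m ^ d * fact (m - 1)))"
    by (simp only: prod.lessThan_Suc power_Suc mult_ac)
  then show ?case unfolding Suc.IH B .
qed simp

text \<open>The factor \<open>fact d\<close> will cancel against the one in
  \<open>card_packings\<close>.\<close>

lemma prod_binomial_W:
  assumes "m \<ge> 1"
  shows "(\<Prod>i<d. (1 + m * i + m - 1) choose m) = fact d * W m (d * m)"
    and "(\<Prod>i<d. (m * (1 + i) + m - 1) choose m) = fact d * (W m (d * m) * lam m (d * m))"
proof -
  have "(\<Prod>i<d. (1 + m * i + m - 1) choose m) * fact m ^ d = fact d * W m (d * m) * fact m ^ d"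
    unfolding prod_binomial_root W_times[OF assms, symmetric] by (simp only: mult_ac)
  then show "(\<Prod>i<d. (1 + m * i + m - 1) choose m) = fact d * W m (d * m)" by simp
  have "lam m (d * m) * (fact (m - 1) * fact (d * m)) = (fact (m - 1 + d * m) :: nat)"
    unfolding lam_def by (rule binomial_fact_add)
  then have "(\<Prod>i<d. (m * (1 + i) + m - 1) choose m) * fact m ^ d * fact (m - 1) =
      lam m (d * m) * (fact (m - 1) * (W m (d * m) * (fact m ^ d * fact d)))"
    unfolding prod_binomial_nonroot[OF assms] W_times[OF assms] by simp
  then have "(\<Prod>i<d. (m * (1 + i) + m - 1) choose m) * (fact m ^ d * fact (m - 1)) =
      fact d * (W m (d * m) * lam m (d * m)) * (fact m ^ d * fact (m - 1))"
    by (simp only: mult_ac)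
  then show "(\<Prod>i<d. (m * (1 + i) + m - 1) choose m) = fact d * (W m (d * m) * lam m (d * m))" by simp
qed

text \<open>The quotient \<open>n_star r m / fact r\<close> will turn out to be
  \<open>FC r m 1\<close>: the \<open>r + 1\<close> possible starts in the only hypertree with one
  hyperedge are divided by its \<open>(r + 1)!\<close> automorphisms.\<close>

definition n_star :: "nat \<Rightarrow> nat \<Rightarrow> nat" where
  "n_star r m = card (circuits m {{..r}} 0)"

lemma card_circuits_single:
  assumes "card e = r + 1" "u \<in> e"
  shows "card (circuits m {e} u) = n_star r m"
proof -
  have "finite e" using assms(1) by (metis card.infinite add_is_0 one_neq_zero)
  then obtain g where g: "bij_betw g e {..r}"
    using finite_same_card_bij[of e "{..r}"] assms(1) by auto
  \<comment> \<open>Corrects the bijection so that \<open>u\<close> goes to the standard start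
    \<open>0\<close>.\<close>
  let ?t = "Transposition.transpose (g u) 0"
  have "?t permutes {..r}" using g assms(2) by (intro permutes_swap_id) (auto simp: bij_betw_def)
  then have "bij_betw (?t \<circ> g) e {..r}"
    using g by (metis bij_betw_trans permutes_imp_bij)
  then have "inj_on (?t \<circ> g) (insert u (\<Union>{e}))" and im: "(?t \<circ> g) ` e = {..r}"
    using assms(2) by (auto simp: bij_betw_def insert_absorb)
  from card_circuits_relabel[OF this(1), of m] \<open>finite e\<close> im show ?thesis
    by (simp add: n_star_def)
qed

text \<open>\<open>card_circuits_insert\<close> is applied to one member of \<open>D\<close> after
  the other; when the next one is attached after \<open>i\<close> others, \<open>a\<close> has
  degree larger by \<open>i\<close> than in \<open>P\<close>.\<close>

lemma card_circuits_attach: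
  assumes r: "r \<ge> 1" and P: "finite P" "\<And>e. e \<in> P \<Longrightarrow> finite e \<and> e \<inter> U = {}"
    and aU: "a \<notin> U" "v \<notin> U" and "finite U" and D: "D \<in> packings r d U"
  shows "card (circuits m (P \<union> insert a ` D) v) = card (circuits m P v) * n_star r m ^ d *
    (\<Prod>i<d. (of_bool (v = a) + m * (card {e\<in>P. a \<in> e} + i) + m - 1) choose m)"
proof -
  have "finite D" using D \<open>finite U\<close> finite_subset[of D "Pow U"] by (simp add: packings_def)
  moreover have "D \<subseteq> Pow U" "\<forall>X\<in>D. card X = r" "pairwise disjnt D"
    using D by (auto simp: packings_def)
  ultimately have "card (circuits m (P \<union> insert a ` D) v) = card (circuits m P v) * n_star r m ^ card D *
    (\<Prod>i<card D. (of_bool (v = a) + m * (card {e\<in>P. a \<in> e} + i) + m - 1) choose m)"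
  proof (induction D)
    case (insert X D)
    let ?P = "P \<union> insert a ` D"
    have X: "X \<subseteq> U" "card X = r" "finite X" "X \<noteq> {}" "a \<notin> X"
    proof -
      show "X \<subseteq> U" "card X = r" using insert.prems by auto
      then show "finite X" "X \<noteq> {}" "a \<notin> X" using \<open>finite U\<close> aU r by (auto simp: finite_subset)
    qed
    have D: "Y \<subseteq> U" "Y \<inter> X = {}" "a \<notin> Y" "Y \<noteq> {}" "finite Y" if "Y \<in> D" for Y
    proof -
      show "Y \<subseteq> U" "a \<notin> Y" using insert.prems(1) that aU by auto
      then show "finite Y" using \<open>finite U\<close> by (metis finite_subset)
      have "card Y = r" using insert.prems(2) that by simp
      then show "Y \<noteq> {}" using r by auto
      have "Y \<noteq> X" using insert.hyps(2) that by blast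
      then have "disjnt Y X" by (intro pairwiseD[OF insert.prems(3)]) (use that in simp_all)
      then show "Y \<inter> X = {}" by (simp add: disjnt_def)
    qed
    have degree: "card {e\<in>?P. a \<in> e} = card {e\<in>P. a \<in> e} + card D"
    proof -
      have "{e\<in>?P. a \<in> e} = {e\<in>P. a \<in> e} \<union> insert a ` D" by auto
      moreover have "insert a Y \<notin> P" if "Y \<in> D" for Y
        using P(2)[of "insert a Y"] D(1,4)[OF that] by blast
      then have "{e\<in>P. a \<in> e} \<inter> insert a ` D = {}" by auto
      moreover have "card (insert a ` D) = card D"
        using D(3) by (intro card_image inj_onI) (metis insert_ident)
      ultimately show ?thesis using P(1) insert.hyps(1) by (simp add: card_Un_disjoint)
    qed
    have "card (circuits m (insert (insert a X) ?P) v) = card (circuits m ?P v) * card (circuits m {insert a X} a) *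
      ((of_bool (v = a) + m * card {e\<in>?P. a \<in> e} + m - 1) choose m)"
    proof (rule card_circuits_insert)
      show "finite ?P" using P(1) insert.hyps(1) by simp
      show "finite e" if "e \<in> insert (insert a X) ?P" for e using that P(2) X(3) D(5) by auto
      show "insert a X \<notin> ?P"
      proof
        assume "insert a X \<in> ?P"
        then consider "insert a X \<in> P" | Y where "Y \<in> D" "insert a X = insert a Y" by auto
        then show False
        proof cases
          case 1
          then show False using P(2)[of "insert a X"] X(1,4) by blast
        next
          case 2
          then show False using X(5) D(3) insert.hyps(2) by (metis insert_ident)
        qed
      qed
      show "e \<inter> insert a X \<subseteq> {a}" if "e \<in> ?P" for e
        using that P(2)[of e] X(1) D(2) by blast
      show "v \<notin> insert a X - {a}" using X(1) aU by auto
    qed simp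
    moreover have "card (circuits m {insert a X} a) = n_star r m"
      using X by (intro card_circuits_single) auto
    moreover have "card (circuits m ?P v) = card (circuits m P v) * n_star r m ^ card D *
        (\<Prod>i<card D. (of_bool (v = a) + m * (card {e\<in>P. a \<in> e} + i) + m - 1) choose m)"
      using insert.prems by (intro insert.IH pairwise_subset[OF insert.prems(3)]) auto
    moreover have "P \<union> insert a ` insert X D = insert (insert a X) ?P" by simp
    moreover have "card (insert X D) = Suc (card D)" using insert.hyps by simp
    ultimately show ?case
      by (simp only: degree power_Suc prod.lessThan_Suc mult_ac)
  qed simp
  then show ?thesis using D by (simp add: packings_def)
qed

text \<open>One step of the recursion. The local weight \<open>w\<close> is left open so that the
  step serves both the start vertex and the other roots; \<open>T d\<close> stands for the
  coefficient belonging to the forest that remains after \<open>d\<close> hyperedges at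
  \<open>a\<close>.\<close>

lemma sum_circuits_peel:
  fixes T :: "nat \<Rightarrow> rat"
  assumes r: "r \<ge> 1" and fin: "finite (R \<union> U)" and RU: "R \<inter> U = {}" and a: "a \<in> R" and n: "card U = r * n"
    and P: "finite P" "\<And>e. e \<in> P \<Longrightarrow> finite e \<and> e \<inter> U = {}" and v: "v \<notin> U"
    and w: "\<And>d. (\<Prod>i<d. (of_bool (v = a) + m * (card {e\<in>P. a \<in> e} + i) + m - 1) choose m) = fact d * w d"
    and T: "\<And>d D. d \<le> n \<Longrightarrow> D \<in> packings r d U \<Longrightarrow>
      (\<Sum>E\<in>hforests r ((R - {a}) \<union> \<Union>D) (U - \<Union>D). of_nat (card (circuits m (P \<union> insert a ` D \<union> E) v))) =
      of_nat (card (circuits m (P \<union> insert a ` D) v)) * (of_nat (n_star r m) / fact r) ^ (n - d) * fact (r * (n - d)) * T d"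
  shows "(\<Sum>E\<in>hforests r R U. of_nat (card (circuits m (P \<union> E) v))) =
    of_nat (card (circuits m P v)) * (of_nat (n_star r m) / fact r) ^ n * fact (r * n) * (\<Sum>d\<le>n. of_nat (w d) * T d)"
proof -
  let ?c = "of_nat (n_star r m) :: rat" and ?b = "of_nat (card (circuits m P v)) :: rat"
  have aU: "a \<notin> U" using a RU by auto
  have "(\<Sum>D\<in>packings r d U. \<Sum>E\<in>hforests r ((R - {a}) \<union> \<Union>D) (U - \<Union>D).
        of_nat (card (circuits m (P \<union> (insert a ` D \<union> E)) v))) =
      ?b * (?c / fact r) ^ n * fact (r * n) * (of_nat (w d) * T d)" if d: "d \<le> n" for d
  proof -
    have le: "r * d \<le> card U" using d n by simp
    have "card U - r * d = r * (n - d)" using n by (simp add: algebra_simps)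
    then have packs: "of_nat (card (packings r d U)) * (fact r ^ d * fact d * fact (r * (n - d))) = (fact (r * n) :: rat)"
      using arg_cong[OF card_packings[OF r _ le], of "of_nat :: nat \<Rightarrow> rat"] fin n by simp
    have "(\<Sum>D\<in>packings r d U. \<Sum>E\<in>hforests r ((R - {a}) \<union> \<Union>D) (U - \<Union>D).
        of_nat (card (circuits m (P \<union> (insert a ` D \<union> E)) v))) =
      (\<Sum>D\<in>packings r d U. ?b * ?c ^ d * (fact d * of_nat (w d)) * (?c / fact r) ^ (n - d) * fact (r * (n - d)) * T d)"
    proof (rule sum.cong[OF refl])
      fix D assume D: "D \<in> packings r d U"
      have "of_nat (card (circuits m (P \<union> insert a ` D) v)) = ?b * ?c ^ d * (fact d * of_nat (w d))"
        using card_circuits_attach[OF r P aU v _ D, of m] fin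
        by (simp only: w finite_Un of_nat_mult of_nat_power of_nat_fact simp_thms)
      then show "(\<Sum>E\<in>hforests r ((R - {a}) \<union> \<Union>D) (U - \<Union>D). of_nat (card (circuits m (P \<union> (insert a ` D \<union> E)) v))) =
        ?b * ?c ^ d * (fact d * of_nat (w d)) * (?c / fact r) ^ (n - d) * fact (r * (n - d)) * T d"
        using T[OF d D] by (simp only: Un_assoc)
    qed
    also have "\<dots> = of_nat (card (packings r d U)) *
        (?b * ?c ^ d * (fact d * of_nat (w d)) * (?c / fact r) ^ (n - d) * fact (r * (n - d)) * T d)"
      by simp
    \<comment> \<open>The powers of \<open>fact r\<close> needed to complete the packing count are
      taken from \<open>?c ^ d\<close>, which is how \<open>?c / fact r\<close> becomes the constant
      per hyperedge.\<close>
    also have "\<dots> = (of_nat (card (packings r d U)) * (fact r ^ d * fact d * fact (r * (n - d)))) *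
        (?b * (?c / fact r) ^ d * of_nat (w d) * (?c / fact r) ^ (n - d) * T d)"
      by (simp add: power_divide)
    also have "\<dots> = ?b * ((?c / fact r) ^ d * (?c / fact r) ^ (n - d)) * fact (r * n) * (of_nat (w d) * T d)"
      unfolding packs by simp
    also have "(?c / fact r) ^ d * (?c / fact r) ^ (n - d) = (?c / fact r) ^ n"
      using d by (simp add: power_add[symmetric])
    finally show ?thesis .
  qed
  then show ?thesis
    unfolding sum_hforests_peel[OF fin RU a n r] by (simp add: sum_distrib_left)
qed

text \<open>What the induction over roots has to preserve: the part already built avoids the
  vertices still to be placed, a new root lies in exactly one of its hyperedges, and the other roots
  keep their degree.\<close>

lemma attach_invariants:
  assumes "finite U" "a \<notin> U" "finite P" "\<forall>e\<in>P. finite e \<and> e \<inter> U = {}" and D: "D \<in> packings r d U"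
  defines "P' \<equiv> P \<union> insert a ` D"
  shows "finite P'" and "e \<in> P' \<Longrightarrow> finite e \<and> e \<inter> (U - \<Union>D) = {}"
    and "b \<in> \<Union>D \<Longrightarrow> card {e\<in>P'. b \<in> e} = 1" and "b \<notin> insert a U \<Longrightarrow> {e\<in>P'. b \<in> e} = {e\<in>P. b \<in> e}"
proof -
  have DU: "\<Union>D \<subseteq> U" and disj: "pairwise disjnt D" using D by (auto simp: packings_def)
  have finD: "finite D" using DU assms(1) by (meson finite_UnionD finite_subset)
  show "finite P'" using assms(3) finD by (simp add: P'_def)
  show "finite e \<and> e \<inter> (U - \<Union>D) = {}" if e: "e \<in> P'"
  proof (cases "e \<in> P")
    case True
    then show ?thesis using assms(4) by blast
  next
    case False
    then obtain X where X: "X \<in> D" "e = insert a X" using e by (auto simp: P'_def)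
    then have "finite X" using DU assms(1) by (meson Union_upper finite_subset)
    then show ?thesis using X assms(2) by auto
  qed
  show "card {e\<in>P'. b \<in> e} = 1" if b: "b \<in> \<Union>D"
  proof -
    obtain X where X: "X \<in> D" "b \<in> X" using b by auto
    then have bU: "b \<in> U" using DU by auto
    then have ba: "b \<noteq> a" using assms(2) by auto
    have *: "Y = X" if "Y \<in> D" "b \<in> Y" for Y
      using disj X that unfolding pairwise_def disjnt_def by blast
    have "{e\<in>P'. b \<in> e} = {insert a X}"
    proof (intro equalityI subsetI)
      fix e assume e: "e \<in> {e\<in>P'. b \<in> e}"
      then have "e \<notin> P" using assms(4) bU by blast
      then obtain Y where "Y \<in> D" "e = insert a Y" using e by (auto simp: P'_def)
      then show "e \<in> {insert a X}" using * e ba by auto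
    qed (use X in \<open>auto simp: P'_def\<close>)
    then show ?thesis by simp
  qed
  show "{e\<in>P'. b \<in> e} = {e\<in>P. b \<in> e}" if "b \<notin> insert a U"
    using that DU by (auto simp: P'_def)
qed

text \<open>\<open>P\<close> is the part already built and \<open>R\<close> the set of its vertices
  whose further hyperedges are still to be chosen. Each pending root contributes one factor
  \<open>L\<close>. The factor \<open>fact (r * n)\<close> is there because the vertices of
  \<open>U\<close> are labelled.\<close>

lemma sum_circuits_hforests:
  fixes f L :: "rat fps"
  assumes r: "r \<ge> 1" and m: "m \<ge> 1" and f: "f = fps_X * L ^ r" and L: "L = ell m oo f"
    and "finite (R \<union> U)" "R \<inter> U = {}" "card U = r * n"
    and "finite P" "\<And>e. e \<in> P \<Longrightarrow> finite e \<and> e \<inter> U = {}" "v \<notin> R \<union> U"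
    and "\<And>a. a \<in> R \<Longrightarrow> card {e\<in>P. a \<in> e} = 1"
  shows "(\<Sum>E\<in>hforests r R U. of_nat (card (circuits m (P \<union> E) v))) =
    of_nat (card (circuits m P v)) * (of_nat (n_star r m) / fact r) ^ n * fact (r * n) * L ^ card R $ n"
  using assms(5-)
proof (induction "card (R \<union> U)" arbitrary: R U n P rule: less_induct)
  case less
  note prems = less.prems
  show ?case
  proof (cases "R = {}")
    case True
    \<comment> \<open>Without roots only the empty forest exists, in accordance with
      \<open>L ^ 0 = 1\<close>.\<close>
    show ?thesis
    proof (cases "U = {}")
      case U: True
      then have n: "n = 0" using prems(3) r by simp
      have "hforests r R U = {{}}"
        unfolding True U by (auto simp: hforests_def)
      then show ?thesis using n True by simp
    next
      case False
      then have "n \<noteq> 0" using prems(1,3) by auto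
      moreover have "hforests r R U = {}" using False True by (auto simp: hforests_def)
      ultimately show ?thesis using True by simp
    qed
  next
    case False
    then obtain a where a: "a \<in> R" by auto
    have "v \<noteq> a" "v \<notin> U" "a \<notin> U" using prems(2,6) a by auto
    have finR: "finite R" "finite U" using prems(1) by auto
    have "(\<Sum>E\<in>hforests r R U. of_nat (card (circuits m (P \<union> E) v))) =
      of_nat (card (circuits m P v)) * (of_nat (n_star r m) / fact r) ^ n * fact (r * n) *
      (\<Sum>d\<le>n. of_nat (W m (d * m) * lam m (d * m)) * L ^ (card R - 1 + r * d) $ (n - d))"
    proof (rule sum_circuits_peel[OF r prems(1,2) a prems(3-5) \<open>v \<notin> U\<close>])
      show "(\<Prod>i<d. (of_bool (v = a) + m * (card {e\<in>P. a \<in> e} + i) + m - 1) choose m) =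
          fact d * (W m (d * m) * lam m (d * m))" for d
        using prod_binomial_W(2)[OF m, of d] prems(7)[OF a] \<open>v \<noteq> a\<close> by simp
    next
      fix d D assume d: "d \<le> n" and D: "D \<in> packings r d U"
      let ?R = "(R - {a}) \<union> \<Union>D" and ?U = "U - \<Union>D" and ?P = "P \<union> insert a ` D"
      have DU: "\<Union>D \<subseteq> U" using D by (auto simp: packings_def)
      have "\<forall>e\<in>P. finite e \<and> e \<inter> U = {}" using prems(5) by blast
      note inv = attach_invariants[OF finR(2) \<open>a \<notin> U\<close> prems(4) this D]
      have cD: "card (\<Union>D) = r * d" using card_Union_packing[OF D finR(2)] .
      have cR: "card ?R = card R - 1 + r * d"
        using finR a DU prems(2) cD by (subst card_Un_disjoint) (auto intro: finite_subset)
      have RU: "?R \<union> ?U = (R \<union> U) - {a}" using DU \<open>a \<notin> U\<close> by auto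
      have "(\<Sum>E\<in>hforests r ?R ?U. of_nat (card (circuits m (?P \<union> E) v))) =
        of_nat (card (circuits m ?P v)) * (of_nat (n_star r m) / fact r) ^ (n - d) * fact (r * (n - d)) *
        L ^ card ?R $ (n - d)"
      proof (rule less.hyps)
        show "card (?R \<union> ?U) < card (R \<union> U)"
          unfolding RU using prems(1) a by (intro psubset_card_mono) auto
        show "finite (?R \<union> ?U)" unfolding RU using prems(1) by simp
        show "?R \<inter> ?U = {}" using prems(2) by auto
        show "card ?U = r * (n - d)"
          using card_Diff_subset[of "\<Union>D" U] finR DU cD prems(3) by (auto simp: algebra_simps intro: finite_subset)
        show "finite ?P" by (rule inv(1))
        show "finite e \<and> e \<inter> ?U = {}" if "e \<in> ?P" for e using that by (rule inv(2))
        show "v \<notin> ?R \<union> ?U" unfolding RU using prems(6) by simp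
        show "card {e\<in>?P. b \<in> e} = 1" if b: "b \<in> ?R" for b
        proof (cases "b \<in> \<Union>D")
          case False
          then have "b \<in> R" "b \<notin> insert a U" using b prems(2) by auto
          then show ?thesis using inv(4) prems(7) by simp
        qed (rule inv(3))
      qed
      then show "(\<Sum>E\<in>hforests r ?R ?U. of_nat (card (circuits m (?P \<union> E) v))) =
        of_nat (card (circuits m ?P v)) * (of_nat (n_star r m) / fact r) ^ (n - d) * fact (r * (n - d)) *
        L ^ (card R - 1 + r * d) $ (n - d)" unfolding cR .
    qed
    \<comment> \<open>The factor \<open>L\<close> belonging to \<open>a\<close> is expanded as
      \<open>ell m oo f\<close>; the other factors are kept.\<close>
    also have "(\<Sum>d\<le>n. of_nat (W m (d * m) * lam m (d * m)) * L ^ (card R - 1 + r * d) $ (n - d)) = L ^ card R $ n"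
    proof -
      have "L ^ card R = (ell m oo f) * L ^ (card R - 1)"
        using finR a L by (metis card_gt_0_iff empty_iff power_eq_if not_gr_zero)
      then show ?thesis using fps_fixpoint_mult_nth[OF f, of "ell m" "card R - 1" n] by (simp add: ell_def)
    qed
    finally show ?thesis .
  qed
qed

text \<open>The first root is the start itself, with the initial visit and no hyperedge built so
  far, so its weight comes from \<open>h m\<close>. All later roots differ from the start and have
  degree one when they are peeled.\<close>

lemma sum_circuits_rooted:
  fixes f L :: "rat fps"
  assumes r: "r \<ge> 1" and m: "m \<ge> 1" and f: "f = fps_X * L ^ r" and L: "L = ell m oo f"
    and U: "finite U" "v \<notin> U" "card U = r * n"
  shows "(\<Sum>E\<in>hforests r {v} U. of_nat (card (circuits m E v))) =
    (of_nat (n_star r m) / fact r) ^ n * fact (r * n) * (h m oo f) $ n"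
proof -
  have nil: "circuits m {} v = {[]}" by (auto simp: circuits_def)
  have "(\<Sum>E\<in>hforests r {v} U. of_nat (card (circuits m ({} \<union> E) v))) =
    of_nat (card (circuits m {} v)) * (of_nat (n_star r m) / fact r) ^ n * fact (r * n) *
    (\<Sum>d\<le>n. of_nat (W m (d * m)) * L ^ (r * d) $ (n - d))"
  proof (rule sum_circuits_peel[OF r])
    show "(\<Prod>i<d. (of_bool (v = v) + m * (card {e\<in>{}. v \<in> e} + i) + m - 1) choose m) = fact d * W m (d * m)" for d
      using prod_binomial_W(1)[OF m, of d] by simp
  next
    fix d D assume d: "d \<le> n" and D: "D \<in> packings r d U"
    let ?P = "{} \<union> insert v ` D"
    have DU: "\<Union>D \<subseteq> U" using D by (auto simp: packings_def)
    have cD: "card (\<Union>D) = r * d" using card_Union_packing[OF D U(1)] .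
    have "\<forall>e\<in>{}. finite e \<and> e \<inter> U = {}" by simp
    note inv = attach_invariants[OF U(1,2) finite.emptyI this D]
    have eq: "{v} - {v} \<union> \<Union>D = \<Union>D" by simp
    have "(\<Sum>E\<in>hforests r (\<Union>D) (U - \<Union>D). of_nat (card (circuits m (?P \<union> E) v))) =
      of_nat (card (circuits m ?P v)) * (of_nat (n_star r m) / fact r) ^ (n - d) * fact (r * (n - d)) *
      L ^ card (\<Union>D) $ (n - d)"
    proof (rule sum_circuits_hforests[OF r m f L])
      show "finite (\<Union>D \<union> (U - \<Union>D))" using DU U(1) by (simp add: finite_subset)
      show "card (U - \<Union>D) = r * (n - d)"
        using card_Diff_subset[of "\<Union>D" U] U DU cD by (auto simp: algebra_simps intro: finite_subset)
      show "finite ?P" by (rule inv(1))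
      show "finite e \<and> e \<inter> (U - \<Union>D) = {}" if "e \<in> ?P" for e using that by (rule inv(2))
      show "card {e\<in>?P. b \<in> e} = 1" if "b \<in> \<Union>D" for b using that by (rule inv(3))
      show "v \<notin> \<Union>D \<union> (U - \<Union>D)" using DU U(2) by auto
    qed auto
    then show "(\<Sum>E\<in>hforests r ({v} - {v} \<union> \<Union>D) (U - \<Union>D). of_nat (card (circuits m (?P \<union> E) v))) =
      of_nat (card (circuits m ?P v)) * (of_nat (n_star r m) / fact r) ^ (n - d) * fact (r * (n - d)) *
      L ^ (r * d) $ (n - d)" unfolding eq cD .
  qed (use U in auto)
  also have "(\<Sum>d\<le>n. of_nat (W m (d * m)) * L ^ (r * d) $ (n - d)) = (h m oo f) $ n"
    using fps_fixpoint_mult_nth[OF f, of "h m" 0 n] by (simp add: h_def)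
  finally show ?thesis by (simp add: nil)
qed

section \<open>Walks on the bipartite graph\<close>

lemma bip_adj_sym: "bip_adj T x y \<longleftrightarrow> bip_adj T y x"
  by (auto simp: bip_adj_def)

lemma bip_adj_isl: "bip_adj T x y \<Longrightarrow> isl x \<longleftrightarrow> \<not> isl y"
  by (auto simp: bip_adj_def)

lemma bip_adj_verts: "bip_adj T x y \<Longrightarrow> x \<in> bip_verts T \<and> y \<in> bip_verts T"
  by (auto simp: bip_adj_def bip_verts_def)

lemma walk_between_snoc:
  assumes "walk_between T u p x" "bip_adj T x y"
  shows "walk_between T u (p @ [y]) y"
  using assms bip_adj_verts[OF assms(2)]
  by (auto simp: walk_between_def walk_def successively_append_iff)

lemma walk_between_parity:
  assumes "walk_between T u p x"
  shows "isl x = (isl u = odd (length p))"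
  using assms
proof (induction p arbitrary: x rule: rev_induct)
  case Nil
  then show ?case by (simp add: walk_between_def walk_def)
next
  case (snoc y p)
  show ?case
  proof (cases "p = []")
    case True
    then show ?thesis using snoc.prems by (auto simp: walk_between_def)
  next
    case False
    then have "walk_between T u p (last p)" "bip_adj T (last p) y" "x = y"
      using snoc.prems by (auto simp: walk_between_def walk_def successively_append_iff)
    then show ?thesis using snoc.IH[of "last p"] bip_adj_isl[of T "last p" y] by auto
  qed
qed

text \<open>Extending a shortest walk shows that neighbouring depths differ by at most one, and by
  parity they cannot be equal.\<close>

lemma depth_adj:
  assumes x: "walk_between T u p x" and xy: "bip_adj T x y"
  shows "depth T u y = Suc (depth T u x) \<or> depth T u x = Suc (depth T u y)"
proof -
  have walk: "\<exists>q. walk_between T u q z \<and> length q = Suc (depth T u z)" if "walk_between T u p z" for p z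
  proof -
    have "p \<noteq> []" using that by (simp add: walk_between_def walk_def)
    then have "\<exists>q. walk_between T u q z \<and> length q = Suc (length p - 1)" using that by auto
    then show ?thesis unfolding depth_def by (rule LeastI)
  qed
  have le: "depth T u z' \<le> Suc (depth T u z)" if z: "walk_between T u p z" and "bip_adj T z z'" for p z z'
  proof -
    obtain q where "walk_between T u q z" "length q = Suc (depth T u z)" using walk[OF z] by blast
    then have "walk_between T u (q @ [z']) z' \<and> length (q @ [z']) = Suc (Suc (depth T u z))"
      using walk_between_snoc[OF _ \<open>bip_adj T z z'\<close>, of u q] by simp
    then show ?thesis unfolding depth_def by (intro Least_le) blast
  qed
  have y: "walk_between T u (p @ [y]) y" using walk_between_snoc[OF x xy] .
  obtain q q' where q: "walk_between T u q x" "length q = Suc (depth T u x)"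
    and q': "walk_between T u q' y" "length q' = Suc (depth T u y)"
    using walk[OF x] walk[OF y] by blast
  have "depth T u x \<noteq> depth T u y"
    using walk_between_parity[OF q(1)] walk_between_parity[OF q'(1)] bip_adj_isl[OF xy] q(2) q'(2) by auto
  then show ?thesis using le[OF x xy] le[OF y, of x] xy by (auto simp: bip_adj_sym)
qed

locale connected_hypergraph =
  fixes T :: "'a hypergraph"
  assumes edges_sub: "e \<in> hedges T \<Longrightarrow> e \<subseteq> verts T" and conn: "hconnected T"
begin

lemma walk_exists:
  assumes "v \<in> verts T" "w \<in> verts T"
  shows "\<exists>p. walk_between T (Inl v) p (Inl w)"
proof -
  have "(v, w) \<in> {(x, y). \<exists>e\<in>hedges T. x \<in> e \<and> y \<in> e}\<^sup>*"
    using conn assms by (simp add: hconnected_def)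
  then show ?thesis
  proof (induction rule: rtrancl_induct)
    case base
    have "walk_between T (Inl v) [Inl v] (Inl v)"
      using assms(1) by (simp add: walk_between_def walk_def bip_verts_def)
    then show ?case by blast
  next
    case (step y z)
    then obtain e p where e: "e \<in> hedges T" "y \<in> e" "z \<in> e" and p: "walk_between T (Inl v) p (Inl y)" by auto
    have "bip_adj T (Inl y) (Inr e)" "bip_adj T (Inr e) (Inl z)"
      using e edges_sub[OF e(1)] by (auto simp: bip_adj_def)
    then show ?case using walk_between_snoc[OF walk_between_snoc[OF p]] by blast
  qed
qed

lemma away_total:
  assumes "v \<in> verts T" "bip_adj T x y"
  shows "away T (Inl v) x y \<or> away T (Inl v) y x"
proof -
  have "away T (Inl v) x y \<or> away T (Inl v) y x" if xy: "bip_adj T x y" and "x = Inl w" for x y w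
  proof -
    have "w \<in> verts T" using that by (auto simp: bip_adj_def)
    then obtain p where "walk_between T (Inl v) p x" using walk_exists assms(1) \<open>x = Inl w\<close> by blast
    from depth_adj[OF this xy] show ?thesis using xy by (auto simp: away_def bip_adj_sym)
  qed
  moreover have "(\<exists>w. x = Inl w) \<or> (\<exists>w. y = Inl w)" using assms(2) by (auto simp: bip_adj_def)
  moreover have "bip_adj T y x" using assms(2) by (simp add: bip_adj_sym)
  ultimately show ?thesis using assms(2) by blast
qed

text \<open>By \<open>away_total\<close> every bipartite edge leads away from \<open>v\<close> in
  one of its directions, so the condition on \<open>away\<close> covers all edges and implies the
  total \<open>2 * m\<close>.\<close>

lemma fc_walks_eq:
  assumes "v \<in> verts T"
  shows "fc_walks m T v = {p. walk_between T (Inl v) p (Inl v) \<and>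
    (\<forall>x y. bip_adj T x y \<longrightarrow> steps p x y = m) \<and> (\<forall>u e. \<not> sublist [Inl u, Inr e, Inl u] p)}"
proof -
  have "(\<forall>x y. bip_adj T x y \<longrightarrow> steps p x y + steps p y x = 2 * m) \<and>
      (\<forall>x y. away T (Inl v) x y \<longrightarrow> steps p x y = m \<and> steps p y x = m) \<longleftrightarrow>
      (\<forall>x y. bip_adj T x y \<longrightarrow> steps p x y = m)" for p
  proof (intro iffI conjI allI impI)
    fix x y assume "\<forall>x y. bip_adj T x y \<longrightarrow> steps p x y = m" "bip_adj T x y"
    then have "steps p x y = m" "steps p y x = m" by (auto simp: bip_adj_sym)
    then show "steps p x y + steps p y x = 2 * m" by simp
  next
    fix x y assume all: "\<forall>x y. bip_adj T x y \<longrightarrow> steps p x y = m" and "away T (Inl v) x y"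
    then have "bip_adj T x y" by (simp add: away_def)
    then show "steps p x y = m" "steps p y x = m" using all by (auto simp: bip_adj_sym)
  next
    fix x y assume "(\<forall>x y. bip_adj T x y \<longrightarrow> steps p x y + steps p y x = 2 * m) \<and>
      (\<forall>x y. away T (Inl v) x y \<longrightarrow> steps p x y = m \<and> steps p y x = m)" "bip_adj T x y"
    then show "steps p x y = m" using away_total[OF assms] by blast
  qed
  then show ?thesis unfolding fc_walks_def by blast
qed

end

section \<open>Correspondence between circuits and walks\<close>

fun expand :: "'a \<Rightarrow> 'a arc list \<Rightarrow> ('a + 'a set) list" where
  "expand v [] = [Inl v]"
| "expand v ((x, e, y) # q) = Inl v # Inr e # expand y q"

lemma expand_neq_Nil [simp]: "expand v q \<noteq> []"
  by (cases "(v, q)" rule: expand.cases) auto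

lemma hd_expand [simp]: "hd (expand v q) = Inl v"
  by (cases "(v, q)" rule: expand.cases) auto

lemma last_expand: "last (expand v q) = Inl (arcs_end v q)"
  by (induction v q rule: expand.induct) auto

text \<open>\<open>expand\<close> drops the first component of each arc; \<open>arcs_from\<close>
  recovers it as the end of the previous arc.\<close>

lemma expand_inject:
  "arcs_from v q \<Longrightarrow> arcs_from v q' \<Longrightarrow> expand v q = expand v q' \<Longrightarrow> q = q'"
proof (induction v q arbitrary: q' rule: expand.induct)
  case (1 v)
  then show ?case by (cases "(v, q')" rule: expand.cases) auto
next
  case (2 v x e y q)
  show ?case
  proof (cases "(v, q')" rule: expand.cases)
    case (2 _ x' e' y' q'')
    then have "expand y q = expand y' q''" "e = e'" using "2.prems"(3) by auto
    then have "y = y'" by (metis hd_expand sum.inject(1))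
    then show ?thesis using "2.prems" "2.IH"[of q''] 2 by auto
  qed (use "2.prems" in auto)
qed

lemma steps_Cons: "p \<noteq> [] \<Longrightarrow> steps (a # p) x y = (if x = a \<and> y = hd p then 1 else 0) + steps p x y"
  by (cases p) (auto simp: steps_def)

lemma steps_single [simp]: "steps [a] x y = 0"
  by (simp add: steps_def)

lemma steps_expand:
  assumes "arcs_from v q"
  shows "steps (expand v q) (Inl u) (Inr e) = n_dep q u e"
    and "steps (expand v q) (Inr e) (Inl u) = n_arr q u e"
  using assms by (induction v q rule: expand.induct) (auto simp: steps_Cons n_dep_def n_arr_def)

lemma expand_no_backtrack:
  "arcs_from v q \<Longrightarrow> \<not> sublist [Inl u, Inr e, Inl u] (expand v q)"
proof (induction v q rule: expand.induct)
  case (2 v x d y q)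
  obtain p where p: "expand y q = Inl y # p"
    using hd_expand[of y q] expand_neq_Nil[of y q] by (cases "expand y q") auto
  then show ?case using 2 by (auto simp: sublist_Cons_right)
qed (simp add: sublist_Cons_right)

context connected_hypergraph
begin

lemma walk_expand:
  "v \<in> verts T \<Longrightarrow> arcs_from v q \<Longrightarrow> arc_edge ` set q \<subseteq> hedges T \<Longrightarrow> walk T (expand v q)"
proof (induction v q rule: expand.induct)
  case (1 v)
  then show ?case by (simp add: walk_def bip_verts_def)
next
  case (2 v x e y q)
  have e: "e \<in> hedges T" "v \<in> e" "y \<in> e" using 2 by auto
  then have y: "y \<in> verts T" using edges_sub by auto
  then have "walk T (expand y q)" using 2 by auto
  then show ?case
    using e y 2(2) by (auto simp: walk_def successively_Cons bip_adj_def bip_verts_def)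
qed

text \<open>Colours alternate, so a walk between black vertices falls into pairs of steps through
  one white vertex, and the forbidden pattern says that the two ends of a pair differ.\<close>

lemma walk_imp_expand:
  assumes "walk T p" "hd p = Inl v" "last p = Inl w" "\<forall>u e. \<not> sublist [Inl u, Inr e, Inl u] p"
  shows "\<exists>q. p = expand v q \<and> arcs_from v q \<and> arc_edge ` set q \<subseteq> hedges T"
  using assms
proof (induction "length p" arbitrary: p v rule: less_induct)
  case less
  obtain p1 where p1: "p = Inl v # p1" using less.prems(1,2) by (cases p) (auto simp: walk_def)
  show ?case
  proof (cases p1)
    case Nil
    then show ?thesis using p1 by (intro exI[of _ "[]"]) simp
  next
    case (Cons b p2)
    then have "bip_adj T (Inl v) b" using less.prems(1) p1 by (auto simp: walk_def)
    then obtain e where e: "b = Inr e" "e \<in> hedges T" "v \<in> e" by (auto simp: bip_adj_def)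
    then have "p2 \<noteq> []" using less.prems(3) p1 Cons by auto
    then obtain c p3 where p2: "p2 = c # p3" by (cases p2) auto
    then have "bip_adj T (Inr e) c" using less.prems(1) p1 Cons e by (auto simp: walk_def)
    then obtain y where y: "c = Inl y" "y \<in> e" by (auto simp: bip_adj_def)
    have p: "p = Inl v # Inr e # Inl y # p3" using p1 Cons e p2 y by simp
    have "\<not> sublist [Inl v, Inr e, Inl v] p" using less.prems(4) by blast
    then have "v \<noteq> y" unfolding p by (auto simp: sublist_Cons_right)
    have "\<exists>q. Inl y # p3 = expand y q \<and> arcs_from y q \<and> arc_edge ` set q \<subseteq> hedges T"
    proof (rule less.hyps)
      show "walk T (Inl y # p3)" using less.prems(1) p by (simp add: walk_def)
      show "last (Inl y # p3) = Inl w" using less.prems(3) p by simp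
      show "\<forall>u e. \<not> sublist [Inl u, Inr e, Inl u] (Inl y # p3)"
        using less.prems(4) unfolding p by (metis sublist_Cons_right)
    qed (use p in auto)
    then obtain q where q: "Inl y # p3 = expand y q" "arcs_from y q" "arc_edge ` set q \<subseteq> hedges T" by blast
    then show ?thesis using p e y \<open>v \<noteq> y\<close> by (intro exI[of _ "(v, e, y) # q"]) auto
  qed
qed

lemma fc_walks_eq_expand:
  assumes v: "v \<in> verts T"
  shows "fc_walks m T v = expand v ` circuits m (hedges T) v"
proof -
  have counts: "(\<forall>x y. bip_adj T x y \<longrightarrow> steps (expand v q) x y = m) \<longleftrightarrow>
      (\<forall>e\<in>hedges T. \<forall>u\<in>e. n_dep q u e = m \<and> n_arr q u e = m)" if "arcs_from v q" for q
  proof (intro iffI ballI allI impI)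
    fix e u assume all: "\<forall>x y. bip_adj T x y \<longrightarrow> steps (expand v q) x y = m" and "e \<in> hedges T" "u \<in> e"
    then have "bip_adj T (Inl u) (Inr e)" "bip_adj T (Inr e) (Inl u)"
      using edges_sub[of e] by (auto simp: bip_adj_def)
    then show "n_dep q u e = m \<and> n_arr q u e = m"
      unfolding steps_expand[OF that, symmetric] using all by blast
  next
    fix x y assume all: "\<forall>e\<in>hedges T. \<forall>u\<in>e. n_dep q u e = m \<and> n_arr q u e = m" and "bip_adj T x y"
    then obtain u e where "e \<in> hedges T" "u \<in> e" "x = Inl u \<and> y = Inr e \<or> x = Inr e \<and> y = Inl u"
      unfolding bip_adj_def by blast
    then show "steps (expand v q) x y = m" using all steps_expand[OF that] by auto
  qed
  show ?thesis unfolding fc_walks_eq[OF v]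
  proof (intro equalityI subsetI)
    fix p assume p: "p \<in> {p. walk_between T (Inl v) p (Inl v) \<and>
      (\<forall>x y. bip_adj T x y \<longrightarrow> steps p x y = m) \<and> (\<forall>u e. \<not> sublist [Inl u, Inr e, Inl u] p)}"
    then obtain q where q: "p = expand v q" "arcs_from v q" "arc_edge ` set q \<subseteq> hedges T"
      using walk_imp_expand[of p v v] by (auto simp: walk_between_def)
    moreover have "arcs_end v q = v" using p q(1) last_expand[of v q] by (auto simp: walk_between_def)
    ultimately show "p \<in> expand v ` circuits m (hedges T) v"
      using p counts[of q] unfolding circuits_def by blast
  next
    fix p assume "p \<in> expand v ` circuits m (hedges T) v"
    then obtain q where q: "p = expand v q" "arcs_from v q" "arcs_end v q = v" "arc_edge ` set q \<subseteq> hedges T"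
      "\<forall>e\<in>hedges T. \<forall>u\<in>e. n_dep q u e = m \<and> n_arr q u e = m" by (auto simp: circuits_def)
    then have "walk_between T (Inl v) p (Inl v)"
      using walk_expand[OF v] last_expand[of v q] by (simp add: walk_between_def)
    then show "p \<in> {p. walk_between T (Inl v) p (Inl v) \<and>
      (\<forall>x y. bip_adj T x y \<longrightarrow> steps p x y = m) \<and> (\<forall>u e. \<not> sublist [Inl u, Inr e, Inl u] p)}"
      using q counts[of q] expand_no_backtrack[of v q] by blast
  qed
qed

lemma card_fc_walks:
  assumes "v \<in> verts T"
  shows "card (fc_walks m T v) = card (circuits m (hedges T) v)"
  unfolding fc_walks_eq_expand[OF assms]
  by (rule card_image, rule inj_onI) (auto simp: circuits_def intro: expand_inject)

end

section \<open>Orbit counting\<close>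

lemma hconnected_iff: "hconnected T \<longleftrightarrow> (\<forall>u\<in>verts T. \<forall>v\<in>verts T. (u, v) \<in> (hadj (hedges T))\<^sup>*)"
  by (simp add: hconnected_def hadj_def)

text \<open>Since adjacency is symmetric, reachability from the one vertex \<open>v\<close> already
  gives connectivity. As \<open>v\<close> is arbitrary, the root can be placed at the start of the
  circuits being counted.\<close>

lemma hypertree_iff_hforest:
  assumes r: "r \<ge> 1" and V: "finite V" "card V = r * n + 1" and v: "v \<in> V"
  shows "hypertree r n (V, E) \<longleftrightarrow> E \<in> hforests r {v} (V - {v})"
proof
  assume "hypertree r n (V, E)"
  then show "E \<in> hforests r {v} (V - {v})"
    using v V by (auto simp: hypertree_def hforests_def hconnected_iff)
next
  assume E: "E \<in> hforests r {v} (V - {v})"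
  have sub: "\<forall>e\<in>E. e \<subseteq> V \<and> card e = r + 1" using E v by (auto simp: hforests_def insert_absorb)
  then have "finite E" using V(1) by (intro finite_subset[of E "Pow V"]) auto
  moreover have "card E = n"
  proof -
    have "card (V - {v}) = r * card E" using E unfolding hforests_def by blast
    then show ?thesis using V v r by simp
  qed
  moreover have "hconnected (V, E)"
    unfolding hconnected_iff
  proof (intro ballI)
    have from_v: "(v, w) \<in> (hadj E)\<^sup>*" if "w \<in> V" for w
      using that E by (cases "w = v") (auto simp: hforests_def)
    fix u w assume "u \<in> verts (V, E)" "w \<in> verts (V, E)"
    moreover have "sym ((hadj E)\<^sup>*)" by (rule sym_rtrancl) (auto simp: sym_def hadj_def)
    ultimately show "(u, w) \<in> (hadj (hedges (V, E)))\<^sup>*"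
      using from_v[of u] from_v[of w] by (auto dest: symD intro: rtrancl_trans)
  qed
  ultimately show "hypertree r n (V, E)" using V sub by (simp add: hypertree_def)
qed

lemma finite_hypertrees: "finite (hypertrees r n)"
proof (rule finite_subset)
  show "hypertrees r n \<subseteq> {{..<r * n + 1}} \<times> Pow (Pow {..<r * n + 1})"
  proof
    fix T assume "T \<in> hypertrees r n"
    then have "verts T = {..<r * n + 1}" "hedges T \<subseteq> Pow {..<r * n + 1}"
      by (auto simp only: hypertrees_def hypertree_def Pow_iff)
    then show "T \<in> {{..<r * n + 1}} \<times> Pow (Pow {..<r * n + 1})" by (simp add: mem_Times_iff)
  qed
qed simp

lemma hypertree_image:
  assumes T: "hypertree r n T" and p: "p permutes verts T"
  shows "hypertree r n (verts T, (`) p ` hedges T)"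
proof -
  have inj: "inj p" using p by (rule permutes_inj)
  have V: "p ` verts T = verts T" using p by (rule permutes_image)
  have "card ((`) p ` hedges T) = card (hedges T)"
    using inj by (intro card_image) (auto intro: inj_onI dest: inj_image_eq_iff[THEN iffD1, rotated])
  moreover have "e \<subseteq> verts T \<and> card e = r + 1" if e: "e \<in> (`) p ` hedges T" for e
  proof -
    obtain d where d: "d \<in> hedges T" "e = p ` d" using e by auto
    then have "d \<subseteq> verts T" "card d = r + 1" using T by (auto simp: hypertree_def)
    then show ?thesis using d V card_image[OF inj_on_subset[OF inj subset_UNIV], of d] by auto
  qed
  moreover have "hconnected (verts T, (`) p ` hedges T)"
    unfolding hconnected_iff
  proof (intro ballI)
    have step: "(p u, p w) \<in> (hadj ((`) p ` hedges T))\<^sup>*" if "(u, w) \<in> (hadj (hedges T))\<^sup>*" for u w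
      using that
    proof induction
      case (step y z)
      then have "(p y, p z) \<in> hadj ((`) p ` hedges T)" by (auto simp: hadj_def)
      with step.IH show ?case by (rule rtrancl_into_rtrancl)
    qed simp
    fix x y assume xy: "x \<in> verts (verts T, (`) p ` hedges T)" "y \<in> verts (verts T, (`) p ` hedges T)"
    then have "x \<in> p ` verts T" "y \<in> p ` verts T" using V by simp_all
    then obtain u w where uw: "u \<in> verts T" "w \<in> verts T" "x = p u" "y = p w" by blast
    then have "(u, w) \<in> (hadj (hedges T))\<^sup>*"
      using T unfolding hypertree_def hconnected_iff by blast
    then show "(x, y) \<in> (hadj (hedges (verts T, (`) p ` hedges T)))\<^sup>*"
      using step uw by simp
  qed
  ultimately show ?thesis using T by (simp add: hypertree_def)
qed

lemma hiso_sym: "hiso S T \<Longrightarrow> \<forall>e\<in>hedges S. e \<subseteq> verts S \<Longrightarrow> hiso T S"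
proof -
  assume "hiso S T" and sub: "\<forall>e\<in>hedges S. e \<subseteq> verts S"
  then obtain p where p: "bij_betw p (verts S) (verts T)" "(`) p ` hedges S = hedges T" by (auto simp: hiso_def)
  let ?q = "inv_into (verts S) p"
  have "?q ` p ` e = e" if "e \<in> hedges S" for e
    using sub that bij_betw_imp_inj_on[OF p(1)] by (intro inv_into_image_cancel) auto
  then have "(`) ?q ` hedges T = hedges S" unfolding p(2)[symmetric] by (force simp: image_iff)
  then show "hiso T S" using bij_betw_inv_into[OF p(1)] by (auto simp: hiso_def)
qed

lemma hiso_trans: "hiso S T \<Longrightarrow> hiso T U \<Longrightarrow> hiso S U"
proof -
  assume "hiso S T" "hiso T U"
  then obtain p q where p: "bij_betw p (verts S) (verts T)" "(`) p ` hedges S = hedges T"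
    and q: "bij_betw q (verts T) (verts U)" "(`) q ` hedges T = hedges U" by (auto simp: hiso_def)
  have "(`) (q \<circ> p) ` hedges S = hedges U"
    unfolding q(2)[symmetric] p(2)[symmetric] by (simp add: image_comp comp_def)
  then show "hiso S U" unfolding hiso_def using bij_betw_trans[OF p(1) q(1)] by blast
qed

definition hiso_rel :: "nat \<Rightarrow> nat \<Rightarrow> nat hypergraph rel" where
  "hiso_rel r n = {(S, T). S \<in> hypertrees r n \<and> T \<in> hypertrees r n \<and> hiso S T}"

lemma equiv_hiso_rel: "equiv (hypertrees r n) (hiso_rel r n)"
proof (rule equivI)
  show "hiso_rel r n \<subseteq> hypertrees r n \<times> hypertrees r n" by (auto simp: hiso_rel_def)
  have "hiso T T" for T :: "nat hypergraph" unfolding hiso_def by (intro exI[of _ id]) auto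
  then show "refl_on (hypertrees r n) (hiso_rel r n)" by (auto simp: hiso_rel_def refl_on_def)
  show "sym (hiso_rel r n)"
  proof (rule symI)
    fix S T assume ST: "(S, T) \<in> hiso_rel r n"
    then have "hypertree r n S" by (simp add: hiso_rel_def hypertrees_def)
    then have "\<forall>e\<in>hedges S. e \<subseteq> verts S" by (simp add: hypertree_def)
    then show "(T, S) \<in> hiso_rel r n" using ST hiso_sym[of S T] by (simp add: hiso_rel_def)
  qed
  show "trans (hiso_rel r n)" by (rule transI) (auto simp: hiso_rel_def intro: hiso_trans)
qed

text \<open>Orbit and stabiliser for the permutations of the vertex set: the class of
  \<open>T\<close> is its orbit, and the permutations carrying \<open>T\<close> to a given member
  form a coset of \<open>Aut T\<close>.\<close>

lemma card_hiso_class: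
  assumes T: "T \<in> hypertrees r n"
  shows "card (hiso_rel r n `` {T}) * card (Aut T) = fact (r * n + 1)"
proof -
  let ?V = "{..<r * n + 1}" and ?E = "hedges T"
  let ?C = "hiso_rel r n `` {T}" and ?P = "{p. p permutes {..<r * n + 1}}"
  let ?act = "\<lambda>p. (?V, (`) p ` ?E)"
  have V: "verts T = ?V" and hT: "hypertree r n T" using T by (auto simp: hypertrees_def)
  have finE: "finite ?E" using hT by (simp add: hypertree_def)
  have act: "?act p \<in> ?C" if p: "p \<in> ?P" for p
  proof -
    have "?act p \<in> hypertrees r n"
      using hypertree_image[OF hT, of p] p V by (simp add: hypertrees_def)
    moreover have "hiso T (?act p)"
      unfolding hiso_def using p V by (intro exI[of _ p]) (auto intro: permutes_imp_bij)
    ultimately show ?thesis using T by (simp add: hiso_rel_def)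
  qed
  have fibre: "card {p \<in> ?P. ?act p = S} = card (Aut T)" if "S \<in> ?C" for S
  proof -
    have S: "hiso T S" "verts S = ?V" using that by (auto simp: hiso_rel_def hypertrees_def)
    then obtain p where p: "bij_betw p ?V ?V" "(`) p ` ?E = hedges S" by (auto simp: hiso_def V)
    \<comment> \<open>\<open>hiso\<close> says nothing about \<open>p\<close> off the vertex set; a
      permutation must be the identity there.\<close>
    define p0 where "p0 x = (if x \<in> ?V then p x else x)" for x
    have "bij_betw p0 ?V ?V" using p(1) by (subst bij_betw_cong[of _ p0 p]) (auto simp: p0_def)
    then have p0: "p0 permutes ?V" by (rule bij_imp_permutes) (simp add: p0_def)
    have "p0 ` e = p ` e" if "e \<in> ?E" for e
      using hT V that by (intro image_cong refl) (auto simp: p0_def hypertree_def)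
    then have p0E: "(`) p0 ` ?E = hedges S" using p(2) by (simp cong: image_cong)
    have inj0: "inj p0" using p0 by (rule permutes_inj)
    have "{p \<in> ?P. ?act p = S} = (\<lambda>q. p0 \<circ> q) ` Aut T"
    proof (intro equalityI subsetI)
      fix q assume q: "q \<in> {p \<in> ?P. ?act p = S}"
      have "inv p0 \<circ> q permutes ?V" using q p0 by (intro permutes_compose permutes_inv) auto
      moreover have "(inv p0 \<circ> q) ` e \<in> ?E" if "e \<in> ?E" for e
      proof -
        have "q ` e \<in> hedges S" using q that by (auto simp: prod_eq_iff)
        then obtain d where "d \<in> ?E" "q ` e = p0 ` d" using p0E by (metis imageE)
        then have "(inv p0 \<circ> q) ` e = inv p0 ` p0 ` d" by (metis image_comp)
        then show ?thesis using inj0 \<open>d \<in> ?E\<close> by (simp add: image_inv_f_f)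
      qed
      moreover have "q = p0 \<circ> (inv p0 \<circ> q)" using permutes_inv_o(1)[OF p0] by (simp add: comp_assoc[symmetric])
      ultimately show "q \<in> (\<lambda>q. p0 \<circ> q) ` Aut T" unfolding Aut_def V by blast
    next
      fix q assume "q \<in> (\<lambda>q. p0 \<circ> q) ` Aut T"
      then obtain q' where q': "q = p0 \<circ> q'" "q' permutes ?V" "\<forall>e\<in>?E. q' ` e \<in> ?E"
        by (auto simp: Aut_def V)
      have "inj_on ((`) q') ?E"
        using permutes_inj[OF q'(2)] by (auto intro: inj_onI dest: inj_image_eq_iff[THEN iffD1, rotated])
      \<comment> \<open>\<open>Aut\<close> only asks that hyperedges go to hyperedges; as there are
        finitely many, the injective map is onto.\<close>
      then have "(`) q' ` ?E = ?E" using q'(3) by (intro endo_inj_surj finE) auto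
      then have "(`) q ` ?E = hedges S"
        unfolding q'(1) p0E[symmetric] by (metis (no_types, lifting) image_comp image_cong image_image)
      moreover have "q permutes ?V" unfolding q'(1) using q'(2) p0 by (rule permutes_compose)
      ultimately show "q \<in> {p \<in> ?P. ?act p = S}" using S(2) by (auto simp: prod_eq_iff)
    qed
    moreover have "inj_on (\<lambda>q. p0 \<circ> q) (Aut T)"
      using inj0 by (intro inj_onI) (metis inj_eq comp_apply ext)
    ultimately show ?thesis by (simp add: card_image)
  qed
  have finC: "finite ?C" by (rule finite_subset[OF _ finite_hypertrees[of r n]]) (auto simp: hiso_rel_def)
  have "fact (r * n + 1) = card ?P" by (rule card_permutations[symmetric]) auto
  also have "?P = (\<Union>S\<in>?C. {p \<in> ?P. ?act p = S})" using act by blast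
  also have "card \<dots> = (\<Sum>S\<in>?C. card {p \<in> ?P. ?act p = S})"
    using finC by (intro card_UN_disjoint) (auto simp: finite_permutations)
  also have "\<dots> = card ?C * card (Aut T)" using fibre by simp
  finally show ?thesis by simp
qed

lemma card_circuits_hiso:
  assumes "hypertree r n S" "bij_betw p (verts S) (verts T)" "(`) p ` hedges S = hedges T" "v \<in> verts S"
  shows "card (circuits m (hedges T) (p v)) = card (circuits m (hedges S) v)"
proof -
  have sub: "e \<subseteq> verts S" if "e \<in> hedges S" for e using assms(1) that by (simp add: hypertree_def)
  have "inj_on p (insert v (\<Union>(hedges S)))"
    by (rule inj_on_subset[OF bij_betw_imp_inj_on[OF assms(2)]]) (use sub assms(4) in auto)
  then have "card (circuits m ((`) p ` hedges S) (p v)) = card (circuits m (hedges S) v)"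
    using assms(1) sub finite_subset[of _ "verts S"]
    by (intro card_circuits_relabel) (auto simp: hypertree_def)
  then show ?thesis using assms(3) by simp
qed

lemma card_fc_walks_hypertree:
  assumes "hypertree r n T" "v \<in> verts T"
  shows "card (fc_walks m T v) = card (circuits m (hedges T) v)"
proof -
  interpret connected_hypergraph T using assms(1) by unfold_locales (auto simp: hypertree_def)
  show ?thesis using assms(2) by (rule card_fc_walks)
qed

text \<open>By \<open>card_hiso_class\<close> a class \<open>C\<close> has
  \<open>1 / card (Aut T) = card C / fact (r * n + 1)\<close>, so its term can be spread evenly over
  its members, on all of which the sum over the starts has the same value.\<close>

lemma FC_eq_sum_hypertrees:
  "FC r m n = (\<Sum>T\<in>hypertrees r n. \<Sum>v<r * n + 1. of_nat (card (circuits m (hedges T) v))) / fact (r * n + 1)"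
proof -
  let ?H = "hypertrees r n" and ?R = "hiso_rel r n" and ?V = "{..<r * n + 1}"
  let ?g = "\<lambda>T. \<Sum>v\<in>?V. of_nat (card (circuits m (hedges T) v)) :: rat"
  have g_hiso: "?g S = ?g T" if "(S, T) \<in> ?R" for S T
  proof -
    have S: "hypertree r n S" "verts S = ?V" "verts T = ?V" "hiso S T"
      using that by (auto simp: hiso_rel_def hypertrees_def)
    then obtain p where p: "bij_betw p (verts S) (verts T)" "(`) p ` hedges S = hedges T" by (auto simp: hiso_def)
    have "?g T = (\<Sum>v\<in>?V. of_nat (card (circuits m (hedges T) (p v))))"
      using p(1) unfolding S by (rule sum.reindex_bij_betw[symmetric])
    also have "\<dots> = ?g S"
      using card_circuits_hiso[OF S(1) p] S(2) by (intro sum.cong) auto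
    finally show ?thesis by simp
  qed
  have cls: "(let T = (SOME T. T \<in> C) in \<Sum>v\<in>verts T. of_nat (card (fc_walks m T v)) / of_nat (card (Aut T))) =
      (\<Sum>T\<in>C. ?g T / fact (r * n + 1))" if C: "C \<in> ?H // ?R" for C
  proof -
    define T where "T = (SOME T. T \<in> C)"
    have "T \<in> C" unfolding T_def using in_quotient_imp_non_empty[OF equiv_hiso_rel C] by (simp add: some_in_eq)
    obtain S where "C = ?R `` {S}" using C by (rule quotientE)
    then have "(S, T) \<in> ?R" using \<open>T \<in> C\<close> by simp
    then have CT: "C = ?R `` {T}" and T: "T \<in> ?H"
      using equiv_class_eq[OF equiv_hiso_rel] \<open>C = ?R `` {S}\<close> by (simp, simp add: hiso_rel_def)
    have hT: "hypertree r n T" and V: "verts T = ?V" using T by (simp_all add: hypertrees_def)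
    have orbit: "of_nat (card C) * of_nat (card (Aut T)) = (fact (r * n + 1) :: rat)"
      using card_hiso_class[OF T] unfolding CT by (metis of_nat_fact of_nat_mult)
    then have "of_nat (card C) \<noteq> (0 :: rat)" by (metis fact_nonzero mult_zero_left)
    then have orbit_div: "x / of_nat (card (Aut T)) = of_nat (card C) * (x / fact (r * n + 1))" for x :: rat
      unfolding orbit[symmetric] by simp
    have "(\<Sum>v\<in>verts T. of_nat (card (fc_walks m T v)) / of_nat (card (Aut T))) = ?g T / of_nat (card (Aut T))"
      unfolding sum_divide_distrib V using card_fc_walks_hypertree[OF hT, of _ m] unfolding V
      by (intro sum.cong refl) simp
    also have "\<dots> = of_nat (card C) * (?g T / fact (r * n + 1))"
      by (rule orbit_div)
    also have "\<dots> = (\<Sum>S\<in>C. ?g T / fact (r * n + 1))" by simp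
    also have "\<dots> = (\<Sum>S\<in>C. ?g S / fact (r * n + 1))"
    proof (rule sum.cong[OF refl])
      fix S assume "S \<in> C"
      then have "(T, S) \<in> ?R" using CT by simp
      then show "?g T / fact (r * n + 1) = ?g S / fact (r * n + 1)" using g_hiso by simp
    qed
    finally show ?thesis unfolding T_def Let_def .
  qed
  have "FC r m n = (\<Sum>C\<in>?H // ?R. \<Sum>T\<in>C. ?g T / fact (r * n + 1))"
    unfolding FC_def hypertree_classes_def hiso_rel_def[symmetric] using cls by (rule sum.cong[OF refl])
  also have "\<dots> = (\<Sum>T\<in>\<Union>(?H // ?R). ?g T / fact (r * n + 1))"
  proof (rule sum.Union_disjoint[symmetric, unfolded comp_def])
    show "\<forall>C\<in>?H // ?R. finite C"
      using finite_hypertrees in_quotient_imp_subset[OF equiv_hiso_rel] by (metis finite_subset)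
    show "\<forall>C\<in>?H // ?R. \<forall>D\<in>?H // ?R. C \<noteq> D \<longrightarrow> C \<inter> D = {}"
      using quotient_disj[OF equiv_hiso_rel] by blast
  qed
  also have "\<Union>(?H // ?R) = ?H" by (rule Union_quotient[OF equiv_hiso_rel])
  finally show ?thesis by (simp add: sum_divide_distrib)
qed

text \<open>After exchanging the sums, each of the \<open>r * n + 1\<close> starts contributes the
  same amount, and this number completes \<open>fact (r * n)\<close> to the denominator.\<close>

lemma FC_eq:
  fixes f L :: "rat fps"
  assumes r: "r \<ge> 1" and m: "m \<ge> 1" and f: "f = fps_X * L ^ r" and L: "L = ell m oo f"
  shows "FC r m n = (of_nat (n_star r m) / fact r) ^ n * (h m oo f) $ n"
proof -
  let ?V = "{..<r * n + 1}" and ?b = "(of_nat (n_star r m) / fact r) ^ n * fact (r * n) * (h m oo f) $ n"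
  have "(\<Sum>T\<in>hypertrees r n. of_nat (card (circuits m (hedges T) v))) = ?b" if v: "v \<in> ?V" for v
  proof -
    have "bij_betw (Pair ?V) (hforests r {v} (?V - {v})) (hypertrees r n)"
      using hypertree_iff_hforest[OF r _ _ v, of n]
      by (intro bij_betw_byWitness[where f' = snd]) (auto simp: hypertrees_def)
    then have "(\<Sum>T\<in>hypertrees r n. of_nat (card (circuits m (hedges T) v))) =
        (\<Sum>E\<in>hforests r {v} (?V - {v}). of_nat (card (circuits m (hedges (?V, E)) v)) :: rat)"
      by (rule sum.reindex_bij_betw[symmetric])
    also have "\<dots> = ?b" using v sum_circuits_rooted[OF r m f L, of "?V - {v}" v n] by simp
    finally show ?thesis .
  qed
  then have "(\<Sum>v\<in>?V. \<Sum>T\<in>hypertrees r n. of_nat (card (circuits m (hedges T) v))) = of_nat (r * n + 1) * ?b"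
    by simp
  then have "FC r m n = of_nat (r * n + 1) * ?b / fact (r * n + 1)"
    unfolding FC_eq_sum_hypertrees by (subst sum.swap) simp
  moreover have "(fact (r * n + 1) :: rat) = of_nat (r * n + 1) * fact (r * n)" by simp
  moreover have "of_nat (r * n + 1) \<noteq> (0 :: rat)" by (metis Suc_eq_plus1 of_nat_neq_0)
  ultimately show ?thesis by (simp only: times_divide_eq_right[symmetric] mult_ac) simp
qed

lemma rat_fps_simps:
  "rat_fps (f * g) = rat_fps f * rat_fps g" "rat_fps (f ^ k) = rat_fps f ^ k"
  "rat_fps fps_X = fps_X" "rat_fps (ell m) = ell m" "rat_fps (f oo g) = rat_fps f oo rat_fps g"
proof -
  show mult: "rat_fps (f * g) = rat_fps f * rat_fps g" for f g
    by (simp add: fps_eq_iff rat_fps_def fps_mult_nth)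
  have "rat_fps 1 = 1" by (simp add: fps_eq_iff rat_fps_def)
  then show power: "rat_fps (f ^ k) = rat_fps f ^ k" for f k by (induction k) (simp_all add: mult)
  show "rat_fps fps_X = fps_X" by (simp add: fps_eq_iff rat_fps_def)
  show "rat_fps (ell m) = ell m" by (simp add: fps_eq_iff rat_fps_def ell_def)
  show "rat_fps (f oo g) = rat_fps f oo rat_fps g"
    unfolding fps_eq_iff fps_compose_nth power[symmetric] by (simp add: rat_fps_def fps_compose_nth)
qed

theorem theorem4p7:
  fixes r m :: nat and f :: "int fps"
  assumes "r \<ge> 1" and "m \<ge> 1"
    and "f = fps_X * (ell m oo f) ^ r"
  shows "FC_series r m =
    fps_X * (h m oo (rat_fps f oo (fps_const (FC r m 1) * fps_X)))"
proof -
  let ?f = "rat_fps f"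
  define L where "L = ell m oo ?f"
  define b :: rat where "b = of_nat (n_star r m) / fact r"
  \<comment> \<open>The numbers \<open>FC\<close> are rational, so the functional equation is
    carried over from \<open>int\<close> to \<open>rat\<close>.\<close>
  have f: "?f = fps_X * L ^ r"
    using arg_cong[OF assms(3), of rat_fps] by (simp only: rat_fps_simps L_def)
  note FC = FC_eq[OF assms(1,2) f L_def, folded b_def]
  have f0: "?f $ 0 = 0" by (subst f) simp
  \<comment> \<open>With this the case \<open>n = 1\<close> of \<open>FC\<close> identifies the
    constant \<open>b\<close> as \<open>FC r m 1\<close>.\<close>
  have "(h m oo ?f) $ 1 = 1"
  proof -
    have "W m 0 = 1" "W m m = 1" "lam m 0 = 1" using assms(2) by (auto simp: W_def lam_def)
    then have "h m $ 1 = (1 :: rat)" "(L ^ r) $ 0 = 1"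
      by (auto simp: h_def L_def ell_def fps_power_zeroth fps_compose_nth)
    then show ?thesis using fps_fixpoint_mult_nth[OF f, of "h m" 0 1] by simp
  qed
  then have b: "FC r m 1 = b" using FC[of 1] by simp
  \<comment> \<open>Replacing the variable by its multiple by \<open>b\<close> scales coefficient
    \<open>n\<close> by \<open>b ^ n\<close>, the factor that \<open>FC\<close> asks for.\<close>
  have "h m oo (?f oo (fps_const b * fps_X)) = (h m oo ?f) oo (fps_const b * fps_X)"
    using f0 by (intro fps_compose_assoc) auto
  then have "(h m oo (?f oo (fps_const b * fps_X))) $ n = FC r m n" for n
    unfolding FC by (simp add: fps_compose_linear)
  then show ?thesis
    unfolding b by (intro fps_ext) (simp add: FC_series_def split: nat.split)
qed

end
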